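(* Let $\gamma>0$, $\gamma_2>0$, $\gamma_1\in\mathbb{R}$, let $N\ge 1$ be an integer, and suppose $u_0\in H^2(\Omega)\cap H_0^1(\Omega)$. Then for any $T>0$ the semi-discrete problem: find $u_N(t)\in S_N$, $t\in[0,T]$, with $u_N(0)=P_Nu_0$ and $$\left(\frac{\partial u_N}{\partial t},v_N\right)+\gamma(\Delta u_N,\Delta v_N)=(\varphi(u_N),\Delta v_N)+(\nabla\cdot\psi(u_N),v_N)\qquad\text{for all } v_N\in S_N,\ t\in[0,T],$$ admits a unique solution $u_N$, and $$u_N\in L^\infty(0,T;H^2_{per}(\Omega))\cap L^2(0,T;H^4_{per}(\Omega)).$$
   Context: $\Omega=[0,2\pi]\times[0,2\pi]$; $(\cdot,\cdot)$ is the $L^2(\Omega)$ inner product. $\varphi(s)=\gamma_2s^3+\gamma_1s^2-s$ and $\psi(s)=s^2$. For a scalar function $f$ of $(x,y)$, $\nabla\cdot f$ means $\partial_xf+\partial_yf$. $S_N=\mathrm{span}\{\sin k_1x\,\sin k_2y:\ k_1,k_2\in\{1,2,\dots,2N\}\}$, and $P_N:L^2(\Omega)\to S_N$ is the $L^2$-orthogonal projection. $H^k_{per}(\Omega)$ is the Sobolev space of functions in $H^k$ that are $2\pi$-periodic in each variable (the closure in $H^k(\Omega)$ of smooth functions $2\pi$-periodic in $x$ and $y$). *)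

theory Defs
  imports "HOL-Analysis.Analysis"
begin

section \<open>The square and its \<open>L\<^sup>2\<close> space\<close>

text \<open>Elements of function spaces over the square are represented by functions on the whole
  plane; the spaces and norms below only look at their restriction to the square, up to null
  sets.\<close>

type_synonym fn2 = "real \<times> real \<Rightarrow> real"

definition Omega :: "(real \<times> real) set" where
  "Omega = {0..2*pi} \<times> {0..2*pi}"

definition L2 :: "fn2 set" where
  "L2 = {f. f \<in> borel_measurable (lebesgue_on Omega) \<and>
            integrable (lebesgue_on Omega) (\<lambda>z. (f z)\<^sup>2)}"

definition L2_inner :: "fn2 \<Rightarrow> fn2 \<Rightarrow> real" where
  "L2_inner f g = integral\<^sup>L (lebesgue_on Omega) (\<lambda>z. f z * g z)"

definition L2_norm :: "fn2 \<Rightarrow> real" where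
  "L2_norm f = sqrt (L2_inner f f)"

section \<open>Classical derivatives and smooth functions\<close>

definition partial_x :: "fn2 \<Rightarrow> fn2" where
  "partial_x f = (\<lambda>(x, y). deriv (\<lambda>s. f (s, y)) x)"

definition partial_y :: "fn2 \<Rightarrow> fn2" where
  "partial_y f = (\<lambda>(x, y). deriv (\<lambda>s. f (x, s)) y)"

definition laplacian :: "fn2 \<Rightarrow> fn2" where
  "laplacian f = (\<lambda>z. partial_x (partial_x f) z + partial_y (partial_y f) z)"

text \<open>The operator written \<open>\<nabla>\<cdot>f\<close> for a scalar \<open>f\<close>.\<close>

definition div_scalar :: "fn2 \<Rightarrow> fn2" where
  "div_scalar f = (\<lambda>z. partial_x f z + partial_y f z)"

fun C_diff :: "nat \<Rightarrow> fn2 \<Rightarrow> bool" where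
  "C_diff 0 f \<longleftrightarrow> continuous_on UNIV f"
| "C_diff (Suc k) f \<longleftrightarrow>
     (\<forall>z. f differentiable (at z)) \<and> C_diff k (partial_x f) \<and> C_diff k (partial_y f)"

definition smooth :: "fn2 \<Rightarrow> bool" where
  "smooth f \<longleftrightarrow> (\<forall>k. C_diff k f)"

text \<open>The support is a closed subset of a bounded set, hence compact.\<close>

definition test_functions :: "fn2 set" where
  "test_functions = {f. smooth f \<and> closure {z. f z \<noteq> 0} \<subseteq> interior Omega}"

definition smooth_periodic :: "fn2 set" where
  "smooth_periodic =
     {f. smooth f \<and> (\<forall>x y. f (x + 2*pi, y) = f (x, y) \<and> f (x, y + 2*pi) = f (x, y))}"

section \<open>Sobolev spaces\<close>

definition weak_deriv :: "nat \<Rightarrow> nat \<Rightarrow> fn2 \<Rightarrow> fn2 \<Rightarrow> bool" where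
  "weak_deriv i j f g \<longleftrightarrow> f \<in> L2 \<and> g \<in> L2 \<and>
     (\<forall>\<eta>\<in>test_functions.
        L2_inner f ((partial_x ^^ i) ((partial_y ^^ j) \<eta>)) = (-1) ^ (i + j) * L2_inner g \<eta>)"

definition H_space :: "nat \<Rightarrow> fn2 set" where
  "H_space k = {f. \<forall>i j. i + j \<le> k \<longrightarrow> (\<exists>g. weak_deriv i j f g)}"

text \<open>Weak derivatives are unique up to null sets, so the choice does not affect the norm.
  The norm is meaningful only on \<open>H_space k\<close>.\<close>

definition H_norm :: "nat \<Rightarrow> fn2 \<Rightarrow> real" where
  "H_norm k f = sqrt (\<Sum>(i, j)\<in>{(i, j). i + j \<le> k}. (L2_norm (SOME g. weak_deriv i j f g))\<^sup>2)"

definition H_closure :: "nat \<Rightarrow> fn2 set \<Rightarrow> fn2 set" where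
  "H_closure k A = {f \<in> H_space k. \<exists>g. (\<forall>n. g n \<in> A \<inter> H_space k) \<and>
                      (\<lambda>n::nat. H_norm k (\<lambda>z. f z - g n z)) \<longlonglongrightarrow> 0}"

definition H10 :: "fn2 set" where
  "H10 = H_closure 1 test_functions"

definition H_per :: "nat \<Rightarrow> fn2 set" where
  "H_per k = H_closure k smooth_periodic"

section \<open>Bochner spaces on \<open>(0,T)\<close>\<close>

definition strongly_measurable ::
    "fn2 set \<Rightarrow> (fn2 \<Rightarrow> real) \<Rightarrow> real \<Rightarrow> (real \<Rightarrow> fn2) \<Rightarrow> bool" where
  "strongly_measurable X nrm T u \<longleftrightarrow>
     (AE t in lebesgue_on {0<..<T}. u t \<in> X) \<and>
     (\<exists>s. (\<forall>n. simple_function (lebesgue_on {0<..<T}) (s n) \<and> (\<forall>t\<in>{0<..<T}. s n t \<in> X)) \<and>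
          (AE t in lebesgue_on {0<..<T}.
             (\<lambda>n::nat. nrm (\<lambda>z. s n t z - u t z)) \<longlonglongrightarrow> 0))"

definition Bochner_Linf :: "fn2 set \<Rightarrow> (fn2 \<Rightarrow> real) \<Rightarrow> real \<Rightarrow> (real \<Rightarrow> fn2) set" where
  "Bochner_Linf X nrm T = {u. strongly_measurable X nrm T u \<and>
     (\<exists>C. AE t in lebesgue_on {0<..<T}. nrm (u t) \<le> C)}"

definition Bochner_L2 :: "fn2 set \<Rightarrow> (fn2 \<Rightarrow> real) \<Rightarrow> real \<Rightarrow> (real \<Rightarrow> fn2) set" where
  "Bochner_L2 X nrm T = {u. strongly_measurable X nrm T u \<and>
     integrable (lebesgue_on {0<..<T}) (\<lambda>t. (nrm (u t))\<^sup>2)}"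

section \<open>The semi-discrete problem\<close>

definition phi :: "real \<Rightarrow> real \<Rightarrow> real \<Rightarrow> real" where
  "phi \<gamma>1 \<gamma>2 s = \<gamma>2 * s ^ 3 + \<gamma>1 * s\<^sup>2 - s"

definition psi :: "real \<Rightarrow> real" where
  "psi s = s\<^sup>2"

text \<open>The span is written out as the set of linear combinations of the finitely many
  generators. Its elements are determined on the plane by their values on the square.\<close>

definition S_space :: "nat \<Rightarrow> fn2 set" where
  "S_space N = {f. \<exists>c. f = (\<lambda>(x, y). \<Sum>k1\<in>{1..2*N}. \<Sum>k2\<in>{1..2*N}.
                         c k1 k2 * (sin (real k1 * x) * sin (real k2 * y)))}"

definition P_proj :: "nat \<Rightarrow> fn2 \<Rightarrow> fn2" where
  "P_proj N f = (THE p. p \<in> S_space N \<and> (\<forall>v\<in>S_space N. L2_inner (\<lambda>z. f z - p z) v = 0))"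

text \<open>Since \<open>S_space N\<close> is finite-dimensional, differentiability in time of an
  \<open>S_space N\<close>-valued map is the same as differentiability at every point of the square.
  The time derivative is one-sided at the end points of the interval.\<close>

definition time_deriv :: "real \<Rightarrow> (real \<Rightarrow> fn2) \<Rightarrow> real \<Rightarrow> fn2" where
  "time_deriv T u t = (\<lambda>z. vector_derivative (\<lambda>s. u s z) (at t within {0..T}))"

definition semidiscrete_solution ::
    "real \<Rightarrow> real \<Rightarrow> real \<Rightarrow> nat \<Rightarrow> real \<Rightarrow> fn2 \<Rightarrow> (real \<Rightarrow> fn2) \<Rightarrow> bool" where
  "semidiscrete_solution \<gamma> \<gamma>1 \<gamma>2 N T u0 u \<longleftrightarrow>
     (\<forall>t\<in>{0..T}. u t \<in> S_space N) \<and>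
     (\<forall>t\<in>{0..T}. \<forall>z. (\<lambda>s. u s z) differentiable (at t within {0..T})) \<and>
     u 0 = P_proj N u0 \<and>
     (\<forall>t\<in>{0..T}. \<forall>v\<in>S_space N.
        L2_inner (time_deriv T u t) v + \<gamma> * L2_inner (laplacian (u t)) (laplacian v)
        = L2_inner (\<lambda>z. phi \<gamma>1 \<gamma>2 (u t z)) (laplacian v)
          + L2_inner (div_scalar (\<lambda>z. psi (u t z))) v)"

end

theory Submission imports Defs "HOL-Computational_Algebra.Polynomial" begin

text \<open>
  The space \<open>S_space N\<close> is finite-dimensional, and the products \<open>sin k1 x * sin k2 y\<close> form an
  orthogonal basis of it. The semi-discrete problem is therefore a system of ordinary differential
  equations for the coefficients of the unknown, and its right-hand side \<open>galerkin_field\<close> is a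
  polynomial in these coefficients. Such a field is Lipschitz on bounded sets, so that solutions are
  unique by Gronwall's inequality and exist as long as they stay bounded.

  Boundedness is the energy estimate \<open>galerkin_field_energy\<close>. Test the equation with the solution
  \<open>u\<close> itself, which vanishes on the boundary. The convection term drops out, because
  \<open>2 u\<^sup>2 (u\<^sub>x + u\<^sub>y)\<close> is the divergence of \<open>2/3 u\<^sup>3\<close>. The nonlinear diffusion
  term becomes minus the integral of \<open>\<phi>'(u) (u\<^sub>x\<^sup>2 + u\<^sub>y\<^sup>2)\<close>, and since
  \<open>\<gamma>2 > 0\<close> the quadratic polynomial \<open>- \<phi>'\<close> is bounded above by
  \<open>C = 1 + \<gamma>1\<^sup>2 / (3 \<gamma>2)\<close>. On \<open>S_space N\<close> the squared norm of the gradient is at most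
  \<open>8 N\<^sup>2\<close> times the squared norm of the function, so the energy grows at most exponentially.
  In \<open>ode_system_global_existence\<close> this a priori bound turns the solution of a truncated, globally
  Lipschitz system, which Picard iteration provides on the whole time interval, into a solution of
  the original one.

  A solution in the sense of \<open>semidiscrete_solution\<close> is differentiable in time only at each point of
  the plane. To compare it with the constructed one, its coefficients are recovered from finitely many
  point values by the discrete sine transform, hence are differentiable and solve the same system
  (\<open>galerkin_coefficients_ode\<close>).

  For the regularity, all elements of \<open>S_space N\<close> are smooth and periodic, and each \<open>H_norm k\<close> is the
  square root of a quadratic form in the coefficients, so continuity of the coefficients in time is
  enough (\<open>sine_sum_Bochner\<close>). As \<open>H_norm\<close> refers to arbitrarily chosen weak derivatives, this needs
  their uniqueness up to null sets, i.e. the fundamental lemma of the calculus of variations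
  (\<open>AE_zero_if_orthogonal_to_test_functions\<close>), which in turn needs smooth bump functions.
\<close>

section \<open>Ordinary differential equations\<close>

text \<open>The function \<open>q t * exp (- K * t)\<close> has a nonpositive derivative.\<close>

lemma gronwall:
  fixes q q' :: "real \<Rightarrow> real"
  assumes q: "\<And>t. t \<in> {0..T} \<Longrightarrow> (q has_real_derivative q' t) (at t within {0..T})"
    and le: "\<And>t. t \<in> {0..T} \<Longrightarrow> q' t \<le> K * q t"
    and t: "t \<in> {0..T}"
  shows "q t \<le> q 0 * exp (K * t)"
proof -
  define p where "p = (\<lambda>s. q s * exp (- K * s))"
  have dp: "(p has_real_derivative (q' s - K * q s) * exp (- K * s)) (at s within {0..T})"
    if "s \<in> {0..T}" for s
    unfolding p_def
    using q[OF that] by (auto intro!: derivative_eq_intros simp: algebra_simps)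
  have "p t \<le> p 0"
  proof (rule DERIV_nonpos_imp_decreasing_open[where f = p])
    show "0 \<le> t" using t by simp
    fix s assume s: "0 < s" "s < t"
    have "at s within {0..T} = at s"
      using s t by (intro at_within_interior) auto
    moreover have "(q' s - K * q s) * exp (- K * s) \<le> 0"
      using le[of s] s t by (intro mult_nonpos_nonneg) auto
    ultimately show "\<exists>y. (p has_real_derivative y) (at s) \<and> y \<le> 0"
      using dp[of s] s t by auto
  next
    have "continuous_on {0..T} p"
      by (rule DERIV_continuous_on[OF dp])
    thus "continuous_on {0..t} p"
      by (rule continuous_on_subset) (use t in auto)
  qed
  hence "q t * exp (- K * t) \<le> q 0" by (simp add: p_def)
  hence "q t * exp (- K * t) * exp (K * t) \<le> q 0 * exp (K * t)"
    by (intro mult_right_mono) auto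
  thus ?thesis by (simp add: mult.assoc flip: exp_add)
qed

text \<open>For a globally Lipschitz field a single application of Banach's fixed point theorem covers the whole
  interval, provided that the sup norm is weighted by \<open>exp (- 2 * L * t)\<close>: integrating
  \<open>L * exp (2 * L * s)\<close> up to \<open>t\<close> gives at most half of \<open>exp (2 * L * t)\<close>.\<close>

lemma picard_lindelof:
  fixes G :: "'a::banach \<Rightarrow> 'a"
  assumes lip: "\<And>x y. norm (G x - G y) \<le> L * norm (x - y)" and L: "L > 0" and T: "T \<ge> 0"
  shows "\<exists>x. x 0 = x0 \<and> (\<forall>t\<in>{0..T}. (x has_vector_derivative G (x t)) (at t within {0..T}))"
proof -
  define l where "l = 2 * L"
  have l: "l > 0" using L by (simp add: l_def)
  have "L-lipschitz_on UNIV G"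
    using lip L by (auto intro!: lipschitz_onI simp: dist_norm)
  hence contG: "continuous_on UNIV G"
    by (rule lipschitz_on_continuous_on)
  \<comment> \<open>The unknown is \<open>v t = exp (- l * t) *\<^sub>R x t\<close>; in these terms the Picard operator is a
    contraction of the sup norm.\<close>
  define h where "h = (\<lambda>(v :: real \<Rightarrow>\<^sub>C 'a) s. G (exp (l * s) *\<^sub>R v s))"
  define P where "P = (\<lambda>(v :: real \<Rightarrow>\<^sub>C 'a) t. exp (- l * t) *\<^sub>R (x0 + integral {0..t} (h v)))"
  have conth: "continuous_on S (h v)" for v S
    unfolding h_def by (intro continuous_on_compose2[OF contG] continuous_intros) auto
  have dI: "((\<lambda>u. integral {0..u} (h v)) has_vector_derivative h v t) (at t within {0..T})"
    if "t \<in> {0..T}" for v t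
    by (rule integral_has_vector_derivative[OF conth that])
  have contP: "continuous_on (cbox 0 T) (P v)" for v
  proof -
    have "continuous_on {0..T} (\<lambda>u. integral {0..u} (h v))"
      by (rule continuous_on_vector_derivative[OF dI])
    thus ?thesis unfolding P_def by (auto intro!: continuous_intros)
  qed
  \<comment> \<open>Bounded continuous functions live on the whole line, so the values outside the interval are
    frozen at those at the end points.\<close>
  have "\<exists>g :: real \<Rightarrow>\<^sub>C 'a. \<forall>x. g x = P v (clamp 0 T x)" for v
    by (rule continuous_on_cbox_bcontfunE[OF contP[of v]]) blast
  then obtain Q where Q: "\<And>v x. apply_bcontfun (Q v) x = P v (clamp 0 T x)" by metis
  have clamp: "clamp 0 T x \<in> {0..T}" for x :: real
    using clamp_in_interval[of 0 T x] T by simp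
  have PP: "norm (P v t - P w t) \<le> 1/2 * dist v w" if t: "t \<in> {0..T}" for v w t
  proof -
    have hh: "norm (h v s - h w s) \<le> L * exp (l * s) * dist v w" for s
    proof -
      have "norm (h v s - h w s) \<le> L * norm (exp (l * s) *\<^sub>R v s - exp (l * s) *\<^sub>R w s)"
        unfolding h_def by (rule lip)
      also have "\<dots> = L * (exp (l * s) * dist (v s) (w s))"
        by (simp add: dist_norm flip: scaleR_diff_right)
      also have "\<dots> \<le> L * (exp (l * s) * dist v w)"
        using L by (intro mult_left_mono dist_bounded) auto
      finally show ?thesis by (simp add: mult.assoc)
    qed
    have FTC: "((\<lambda>s. L * exp (l * s) * dist v w) has_integral
             (exp (l * t) / 2 * dist v w - exp (l * 0) / 2 * dist v w)) {0..t}"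
      using t l by (intro fundamental_theorem_of_calculus)
        (auto simp: l_def intro!: derivative_eq_intros simp flip: has_real_derivative_iff_has_vector_derivative)
    have "P v t - P w t = exp (- l * t) *\<^sub>R (integral {0..t} (h v) - integral {0..t} (h w))"
      by (simp add: P_def algebra_simps)
    also have "integral {0..t} (h v) - integral {0..t} (h w) = integral {0..t} (\<lambda>s. h v s - h w s)"
      by (intro integral_diff[symmetric] integrable_continuous_real conth)
    finally have "norm (P v t - P w t) = exp (- l * t) * norm (integral {0..t} (\<lambda>s. h v s - h w s))"
      by simp
    also have "norm (integral {0..t} (\<lambda>s. h v s - h w s))
        \<le> integral {0..t} (\<lambda>s. L * exp (l * s) * dist v w)"
      using FTC hh
      by (intro integral_norm_bound_integral integrable_continuous_real continuous_intros conth) auto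
    also have "\<dots> = exp (l * t) / 2 * dist v w - 1 / 2 * dist v w"
      by (subst integral_unique[OF FTC]) simp
    also have "\<dots> \<le> exp (l * t) / 2 * dist v w" by simp
    finally have "norm (P v t - P w t) \<le> exp (- l * t) * (exp (l * t) / 2 * dist v w)"
      by simp
    also have "\<dots> = 1/2 * dist v w" by (simp add: exp_minus)
    finally show ?thesis .
  qed
  have "\<exists>!v. Q v = v"
  proof (rule banach_fix_type[of "1/2"])
    show "\<forall>x y. dist (Q x) (Q y) \<le> 1/2 * dist x y"
      using PP[OF clamp] by (intro allI dist_bound) (simp add: Q dist_norm[of "P _ _"])
  qed auto
  then obtain v where v: "Q v = v" by blast
  define x where "x = (\<lambda>t. x0 + integral {0..t} (h v))"
  have hv: "h v t = G (x t)" if "t \<in> {0..T}" for t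
  proof -
    have "apply_bcontfun v t = P v t"
      using Q[of v t] that by (simp add: v)
    thus ?thesis by (simp add: h_def P_def x_def exp_minus)
  qed
  have "(x has_vector_derivative G (x t)) (at t within {0..T})" if "t \<in> {0..T}" for t
    using dI[OF that, of v] unfolding hv[OF that]
    by (simp add: x_def[abs_def] has_vector_derivative_add_const add.commute[of x0])
  moreover have "x 0 = x0" by (simp add: x_def)
  ultimately show ?thesis by blast
qed

text \<open>States are families of coordinates of which only those in \<open>I\<close> count. Bounds are taken
  coordinatewise and distances are sums, so that no norm on \<open>'i \<Rightarrow> real\<close> is involved and the size
  of \<open>I\<close> may vary.\<close>

definition lipschitz_on_bounded :: "'i set \<Rightarrow> (('i \<Rightarrow> real) \<Rightarrow> real) \<Rightarrow> bool" where
  "lipschitz_on_bounded I f \<longleftrightarrow> (\<forall>M. \<exists>L. \<forall>a b. (\<forall>i\<in>I. \<bar>a i\<bar> \<le> M) \<longrightarrow> (\<forall>i\<in>I. \<bar>b i\<bar> \<le> M) \<longrightarrow>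
     \<bar>f a - f b\<bar> \<le> L * (\<Sum>i\<in>I. \<bar>a i - b i\<bar>))"

lemma lipschitz_on_bounded_uniform:
  assumes I: "finite I" and F: "\<And>i. i \<in> I \<Longrightarrow> lipschitz_on_bounded I (F i)"
  shows "\<exists>L>0. \<forall>i\<in>I. \<forall>a b. (\<forall>i\<in>I. \<bar>a i\<bar> \<le> M) \<longrightarrow> (\<forall>i\<in>I. \<bar>b i\<bar> \<le> M) \<longrightarrow>
     \<bar>F i a - F i b\<bar> \<le> L * (\<Sum>i\<in>I. \<bar>a i - b i\<bar>)"
proof -
  have "\<forall>i\<in>I. \<exists>L. \<forall>a b. (\<forall>i\<in>I. \<bar>a i\<bar> \<le> M) \<longrightarrow> (\<forall>i\<in>I. \<bar>b i\<bar> \<le> M) \<longrightarrow>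
     \<bar>F i a - F i b\<bar> \<le> L * (\<Sum>i\<in>I. \<bar>a i - b i\<bar>)"
    using F unfolding lipschitz_on_bounded_def by blast
  from bchoice[OF this] obtain l where l: "\<And>i a b. i \<in> I \<Longrightarrow> \<forall>i\<in>I. \<bar>a i\<bar> \<le> M \<Longrightarrow>
     \<forall>i\<in>I. \<bar>b i\<bar> \<le> M \<Longrightarrow> \<bar>F i a - F i b\<bar> \<le> l i * (\<Sum>i\<in>I. \<bar>a i - b i\<bar>)"
    by blast
  define L where "L = 1 + (\<Sum>i\<in>I. \<bar>l i\<bar>)"
  have "L > 0" by (simp add: L_def add_pos_nonneg sum_nonneg)
  moreover have "\<bar>F i a - F i b\<bar> \<le> L * (\<Sum>i\<in>I. \<bar>a i - b i\<bar>)"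
    if "i \<in> I" "\<forall>i\<in>I. \<bar>a i\<bar> \<le> M" "\<forall>i\<in>I. \<bar>b i\<bar> \<le> M" for i a b
  proof -
    have "l i \<le> L"
      using member_le_sum[of i I "\<lambda>i. \<bar>l i\<bar>"] that(1) I by (simp add: L_def)
    thus ?thesis
      using l[OF that] by (meson abs_ge_zero mult_right_mono order_trans sum_nonneg)
  qed
  ultimately show ?thesis by blast
qed

instance bcontfun :: (metric_space, banach) banach ..

text \<open>The size of the system is not fixed by a type, so the states have to be embedded in one Banach
  space that has room for all of them. Coordinate \<open>i\<close> becomes the value at the integer \<open>to_nat i\<close> of a
  bounded continuous function that interpolates by hat functions, each of which vanishes at all other integers.\<close>

lemma ode_system_global_lipschitz:
  fixes G :: "'i::countable \<Rightarrow> ('i \<Rightarrow> real) \<Rightarrow> real"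
  assumes I: "finite I" and T: "T \<ge> 0" and L: "L > 0"
    and lip: "\<And>i a b. i \<in> I \<Longrightarrow> \<bar>G i a - G i b\<bar> \<le> L * (\<Sum>i\<in>I. \<bar>a i - b i\<bar>)"
  shows "\<exists>x. \<forall>i\<in>I. x 0 i = x0 i \<and>
    (\<forall>t\<in>{0..T}. ((\<lambda>s. x s i) has_real_derivative G i (x t)) (at t within {0..T}))"
proof -
  define tent :: "'i \<Rightarrow> real \<Rightarrow> real" where "tent = (\<lambda>i s. max 0 (1 - \<bar>s - real (to_nat i)\<bar>))"
  define emb :: "('i \<Rightarrow> real) \<Rightarrow> (real \<Rightarrow>\<^sub>C real)" where "emb = (\<lambda>a. Bcontfun (\<lambda>s. \<Sum>i\<in>I. a i * tent i s))"
  have tent01: "0 \<le> tent i s" "tent i s \<le> 1" for i s by (auto simp: tent_def)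
  have tent_nat: "tent i (real (to_nat j)) = (if i = j then 1 else 0)" for i j
  proof -
    have "\<bar>real (to_nat j) - real (to_nat i)\<bar> \<ge> 1" if "i \<noteq> j"
      using that inj_to_nat[THEN injD, of i j] by linarith
    thus ?thesis by (auto simp: tent_def)
  qed
  have bound: "\<bar>\<Sum>i\<in>I. a i * tent i s\<bar> \<le> (\<Sum>i\<in>I. \<bar>a i\<bar>)" for a s
    using mult_left_mono[OF tent01(2)]
    by (intro order_trans[OF sum_abs] sum_mono) (auto simp: abs_mult tent01)
  have emb: "apply_bcontfun (emb a) s = (\<Sum>i\<in>I. a i * tent i s)" for a s
    unfolding emb_def
  proof (subst Bcontfun_inverse)
    have "continuous_on UNIV (\<lambda>s. \<Sum>i\<in>I. a i * tent i s)"
      unfolding tent_def by (intro continuous_intros)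
    thus "(\<lambda>s. \<Sum>i\<in>I. a i * tent i s) \<in> bcontfun"
      using bound by (intro bcontfun_normI) auto
  qed simp
  have emb_I: "apply_bcontfun (emb a) (real (to_nat i)) = a i" if "i \<in> I" for a i
    using that I by (simp add: emb tent_nat if_distrib sum.delta cong: if_cong)
  define crd where "crd = (\<lambda>(X :: real \<Rightarrow>\<^sub>C real) i. X (real (to_nat (i :: 'i))))"
  define H where "H = (\<lambda>X. emb (\<lambda>i. G i (crd X)))"
  define M where "M = real (card I) * (L * real (card I)) + 1"
  have HH: "norm (H X - H Y) \<le> M * norm (X - Y)" for X Y
  proof (rule norm_bound)
    fix s
    have crd: "\<bar>crd X i - crd Y i\<bar> \<le> norm (X - Y)" for i
      using norm_bounded[of "X - Y" "real (to_nat i)"] by (simp add: crd_def)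
    have "apply_bcontfun (H X - H Y) s = (\<Sum>i\<in>I. (G i (crd X) - G i (crd Y)) * tent i s)"
      by (simp add: H_def emb left_diff_distrib sum_subtractf)
    hence "norm (apply_bcontfun (H X - H Y) s) \<le> (\<Sum>i\<in>I. \<bar>G i (crd X) - G i (crd Y)\<bar>)"
      using bound by simp
    also have "\<dots> \<le> (\<Sum>i\<in>I. L * (\<Sum>j\<in>I. norm (X - Y)))"
      using L crd by (intro sum_mono order_trans[OF lip] mult_left_mono) auto
    also have "\<dots> \<le> M * norm (X - Y)"
      by (simp add: M_def algebra_simps)
    finally show "norm (apply_bcontfun (H X - H Y) s) \<le> M * norm (X - Y)" .
  qed
  have "M > 0" using L by (simp add: M_def add_nonneg_pos)
  have "\<exists>X. X 0 = emb x0 \<and> (\<forall>t\<in>{0..T}. (X has_vector_derivative H (X t)) (at t within {0..T}))"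
    by (intro picard_lindelof[OF HH] T \<open>M > 0\<close>)
  then obtain X where X: "X 0 = emb x0"
    "\<And>t. t \<in> {0..T} \<Longrightarrow> (X has_vector_derivative H (X t)) (at t within {0..T})" by blast
  have bl: "bounded_linear (\<lambda>X :: real \<Rightarrow>\<^sub>C real. X n)" for n
    by (rule bounded_linear_intro[where K = 1]) (simp, simp, metis mult.right_neutral norm_bounded)
  show ?thesis
  proof (intro exI[of _ "\<lambda>t. crd (X t)"] ballI conjI)
    fix i assume i: "i \<in> I"
    show "crd (X 0) i = x0 i" using i by (simp add: crd_def X emb_I)
    fix t assume t: "t \<in> {0..T}"
    show "((\<lambda>s. crd (X s) i) has_real_derivative G i (crd (X t))) (at t within {0..T})"
      using bounded_linear.has_vector_derivative[OF bl X(2)[OF t], of "real (to_nat i)"] i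
      by (simp add: crd_def H_def emb_I has_real_derivative_iff_has_vector_derivative)
  qed
qed

lemma sum_squares_deriv:
  assumes "\<And>i. i \<in> I \<Longrightarrow> ((\<lambda>s. x s i) has_real_derivative x' i) (at t within S)"
  shows "((\<lambda>s. \<Sum>i\<in>I. (x s i)\<^sup>2) has_real_derivative 2 * (\<Sum>i\<in>I. x' i * x t i)) (at t within S)"
  unfolding sum_distrib_left
proof (rule DERIV_sum)
  fix i assume "i \<in> I"
  from assms[OF this] show "((\<lambda>s. (x s i)\<^sup>2) has_real_derivative 2 * (x' i * x t i)) (at t within S)"
    by (auto intro!: derivative_eq_intros)
qed

text \<open>An a priori bound turns local existence into global existence: replace the field by one that agrees
  with it on a box containing all states that the energy inequality permits up to time \<open>T\<close> and that
  is globally Lipschitz, and show that the solution of the truncated system never leaves the box.\<close>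

lemma ode_system_global_existence:
  fixes F :: "'i::countable \<Rightarrow> ('i \<Rightarrow> real) \<Rightarrow> real"
  assumes I: "finite I" and T: "T \<ge> 0"
    and F: "\<And>i. i \<in> I \<Longrightarrow> lipschitz_on_bounded I (F i)"
    and cong: "\<And>i a b. i \<in> I \<Longrightarrow> (\<And>j. j \<in> I \<Longrightarrow> a j = b j) \<Longrightarrow> F i a = F i b"
    and energy: "\<And>a. (\<Sum>i\<in>I. F i a * a i) \<le> K * (\<Sum>i\<in>I. (a i)\<^sup>2)"
  shows "\<exists>x. \<forall>i\<in>I. x 0 i = x0 i \<and>
    (\<forall>t\<in>{0..T}. ((\<lambda>s. x s i) has_real_derivative F i (x t)) (at t within {0..T}))"
proof -
  define E where "E = (\<lambda>a :: 'i \<Rightarrow> real. \<Sum>i\<in>I. (a i)\<^sup>2)"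
  \<comment> \<open>The exponential term is the largest energy that the energy inequality allows. The summand 1
    makes the bound strict and also gives \<open>R \<le> R\<^sup>2\<close>, so that energy below \<open>R\<close> keeps the
    coordinates below \<open>R\<close>.\<close>
  define R where "R = 1 + E x0 * exp (2 * \<bar>K\<bar> * T)"
  have E0: "E a \<ge> 0" for a by (simp add: E_def sum_nonneg)
  have R: "R \<ge> 1" by (simp add: R_def E0)
  define cl where "cl = (\<lambda>s. max (- R) (min R s))"
  define G where "G = (\<lambda>i a. F i (\<lambda>j. cl (a j)))"
  obtain L where L: "L > 0" and lip: "\<And>i a b. i \<in> I \<Longrightarrow> \<forall>i\<in>I. \<bar>a i\<bar> \<le> R \<Longrightarrow> \<forall>i\<in>I. \<bar>b i\<bar> \<le> R \<Longrightarrow>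
     \<bar>F i a - F i b\<bar> \<le> L * (\<Sum>i\<in>I. \<bar>a i - b i\<bar>)"
    using lipschitz_on_bounded_uniform[of I F R] I F by blast
  have cl: "\<bar>cl s\<bar> \<le> R" "\<bar>cl s - cl r\<bar> \<le> \<bar>s - r\<bar>" "\<bar>s\<bar> \<le> R \<Longrightarrow> cl s = s" for s r
    using R by (auto simp: cl_def max_def min_def)
  have "\<bar>G i a - G i b\<bar> \<le> L * (\<Sum>i\<in>I. \<bar>a i - b i\<bar>)" if "i \<in> I" for i a b
  proof -
    have "\<bar>G i a - G i b\<bar> \<le> L * (\<Sum>i\<in>I. \<bar>cl (a i) - cl (b i)\<bar>)"
      unfolding G_def using that by (intro lip) (auto simp: cl)
    also have "\<dots> \<le> L * (\<Sum>i\<in>I. \<bar>a i - b i\<bar>)"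
      using L by (intro mult_left_mono sum_mono cl) auto
    finally show ?thesis .
  qed
  from ode_system_global_lipschitz[where G = G and ?x0.0 = x0, OF I T L this]
  obtain x where "\<forall>i\<in>I. x 0 i = x0 i \<and>
      (\<forall>t\<in>{0..T}. ((\<lambda>s. x s i) has_real_derivative G i (x t)) (at t within {0..T}))" by blast
  hence x0: "\<And>i. i \<in> I \<Longrightarrow> x 0 i = x0 i"
    and x: "\<And>i t. i \<in> I \<Longrightarrow> t \<in> {0..T} \<Longrightarrow>
              ((\<lambda>s. x s i) has_real_derivative G i (x t)) (at t within {0..T})" by blast+
  have GF: "G i (x t) = F i (x t)" if "E (x t) \<le> R" "i \<in> I" for i t
    unfolding G_def
  proof (rule cong[OF that(2)])
    fix j assume j: "j \<in> I"
    have "(x t j)\<^sup>2 \<le> E (x t)"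
      unfolding E_def using j I by (intro member_le_sum) auto
    hence "(x t j)\<^sup>2 \<le> R\<^sup>2" using that(1) R self_le_power[of R 2] by linarith
    hence "\<bar>x t j\<bar> \<le> R" using R by (simp add: abs_le_square_iff[symmetric])
    thus "cl (x t j) = x t j" by (rule cl)
  qed
  have dE: "((\<lambda>s. E (x s)) has_real_derivative 2 * (\<Sum>i\<in>I. G i (x t) * x t i)) (at t within {0..T})"
    if "t \<in> {0..T}" for t
    unfolding E_def using x that by (intro sum_squares_deriv)
  have contE: "continuous_on {0..T} (\<lambda>s. E (x s))"
    by (rule DERIV_continuous_on[OF dE])
  \<comment> \<open>Before the first time at which the energy reaches \<open>R\<close> the truncation is inactive, so the
    energy inequality applies and keeps the energy below \<open>R\<close>.\<close>
  have below: "E (x t) < R" if t: "t \<in> {0..T}" for t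
  proof (rule ccontr)
    assume "\<not> E (x t) < R"
    define B where "B = {s \<in> {0..T}. R \<le> E (x s)}"
    have "closed B"
      using continuous_closed_preimage[OF contE closed_atLeastAtMost closed_atLeast[of R]]
      by (simp add: B_def vimage_def Int_def)
    moreover have "B \<subseteq> {0..T}" by (auto simp: B_def)
    ultimately have "compact B"
      by (meson bounded_closed_interval bounded_subset compact_eq_bounded_closed)
    moreover have "B \<noteq> {}" using t \<open>\<not> E (x t) < R\<close> by (auto simp: B_def)
    ultimately obtain s where s: "s \<in> B" "\<And>r. r \<in> B \<Longrightarrow> s \<le> r"
      using compact_attains_inf by metis
    have sT: "s \<in> {0..T}" and Rs: "R \<le> E (x s)" using s(1) by (auto simp: B_def)
    have ltR: "E (x r) < R" if "r \<in> {0..<s}" for r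
      using s(2)[of r] that sT by (force simp: B_def)
    have Ex0: "E (x 0) = E x0" by (simp add: E_def x0)
    have "1 \<le> exp (2 * \<bar>K\<bar> * T)" using T by simp
    hence "E x0 * 1 \<le> E x0 * exp (2 * \<bar>K\<bar> * T)" by (intro mult_left_mono E0)
    hence "s \<noteq> 0" using Rs Ex0 by (auto simp: R_def)
    hence "s > 0" using sT by simp
    have leR: "E (x r) \<le> R" if "r \<in> {0..s}" for r
    proof -
      have "continuous_on (closure {0..<s}) (\<lambda>s. E (x s))"
        using \<open>s > 0\<close> sT by (auto intro: continuous_on_subset[OF contE])
      moreover have "r \<in> closure {0..<s}" using \<open>s > 0\<close> that by auto
      ultimately show ?thesis
        by (rule continuous_le_on_closure) (use ltR in force)
    qed
    have "E (x s) \<le> E (x 0) * exp (2 * \<bar>K\<bar> * s)"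
    proof (rule gronwall[where T = s])
      fix r assume r: "r \<in> {0..s}"
      show "((\<lambda>s. E (x s)) has_real_derivative 2 * (\<Sum>i\<in>I. G i (x r) * x r i)) (at r within {0..s})"
        using r sT by (intro DERIV_subset[OF dE]) auto
      have "(\<Sum>i\<in>I. G i (x r) * x r i) = (\<Sum>i\<in>I. F i (x r) * x r i)"
        using GF[OF leR[OF r]] by simp
      also have "\<dots> \<le> K * E (x r)" unfolding E_def by (rule energy)
      also have "\<dots> \<le> \<bar>K\<bar> * E (x r)" by (intro mult_right_mono E0) simp
      finally show "2 * (\<Sum>i\<in>I. G i (x r) * x r i) \<le> 2 * \<bar>K\<bar> * E (x r)" by simp
    qed (use \<open>s > 0\<close> in auto)
    also have "\<dots> \<le> E x0 * exp (2 * \<bar>K\<bar> * T)"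
      using sT unfolding Ex0 by (intro mult_left_mono E0) (auto intro!: mult_left_mono)
    finally show False using Rs by (simp add: R_def)
  qed
  show ?thesis
    using x0 x GF[OF less_imp_le[OF below]] by (intro exI[of _ x]) fastforce
qed

text \<open>Both solutions are continuous on a compact interval, hence stay in a box on which the field is
  Lipschitz. Gronwall's inequality applies to the squared distance; the number of coordinates enters
  through the Cauchy-Schwarz inequality for \<open>(\<Sum>\<bar>x i - y i\<bar>)\<^sup>2\<close>.\<close>

lemma ode_system_unique:
  fixes F :: "'i \<Rightarrow> ('i \<Rightarrow> real) \<Rightarrow> real"
  assumes I: "finite I"
    and F: "\<And>i. i \<in> I \<Longrightarrow> lipschitz_on_bounded I (F i)"
    and x: "\<And>i t. i \<in> I \<Longrightarrow> t \<in> {0..T} \<Longrightarrow>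
              ((\<lambda>s. x s i) has_real_derivative F i (x t)) (at t within {0..T})"
    and y: "\<And>i t. i \<in> I \<Longrightarrow> t \<in> {0..T} \<Longrightarrow>
              ((\<lambda>s. y s i) has_real_derivative F i (y t)) (at t within {0..T})"
    and init: "\<And>i. i \<in> I \<Longrightarrow> x 0 i = y 0 i"
    and t: "t \<in> {0..T}" and i: "i \<in> I"
  shows "x t i = y t i"
proof -
  have bdd: "\<exists>M. \<forall>i\<in>I. \<forall>t\<in>{0..T}. \<bar>z t i\<bar> \<le> M"
    if z: "\<And>i t. i \<in> I \<Longrightarrow> t \<in> {0..T} \<Longrightarrow>
              ((\<lambda>s. z s i) has_real_derivative F i (z t)) (at t within {0..T})" for z
  proof -
    have "\<exists>M. \<forall>t\<in>{0..T}. \<bar>z t i\<bar> \<le> M" if "i \<in> I" for i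
    proof -
      have "continuous_on {0..T} (\<lambda>s. z s i)"
        by (rule DERIV_continuous_on[OF z[OF that]])
      hence "bounded ((\<lambda>s. z s i) ` {0..T})"
        by (intro compact_imp_bounded compact_continuous_image) auto
      thus ?thesis by (auto simp: bounded_iff)
    qed
    then obtain m where m: "\<And>i t. i \<in> I \<Longrightarrow> t \<in> {0..T} \<Longrightarrow> \<bar>z t i\<bar> \<le> m i" by metis
    have "\<bar>z t i\<bar> \<le> (\<Sum>i\<in>I. \<bar>m i\<bar>)" if "i \<in> I" "t \<in> {0..T}" for i t
      using m[OF that] member_le_sum[of i I "\<lambda>i. \<bar>m i\<bar>"] that I by force
    thus ?thesis by blast
  qed
  from bdd[OF x] bdd[OF y] obtain M1 M2 where
    M: "\<And>i t. i \<in> I \<Longrightarrow> t \<in> {0..T} \<Longrightarrow> \<bar>x t i\<bar> \<le> M1" "\<And>i t. i \<in> I \<Longrightarrow> t \<in> {0..T} \<Longrightarrow> \<bar>y t i\<bar> \<le> M2"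
    by metis
  obtain L where L: "L > 0" and lip: "\<And>i a b. i \<in> I \<Longrightarrow> \<forall>i\<in>I. \<bar>a i\<bar> \<le> max M1 M2 \<Longrightarrow>
     \<forall>i\<in>I. \<bar>b i\<bar> \<le> max M1 M2 \<Longrightarrow> \<bar>F i a - F i b\<bar> \<le> L * (\<Sum>i\<in>I. \<bar>a i - b i\<bar>)"
    using lipschitz_on_bounded_uniform[of I F "max M1 M2"] I F by blast
  define q where "q = (\<lambda>t. \<Sum>i\<in>I. (x t i - y t i)\<^sup>2)"
  have "q t \<le> q 0 * exp (2 * L * card I * t)"
  proof (rule gronwall[OF _ _ t])
    fix r assume r: "r \<in> {0..T}"
    show "(q has_real_derivative 2 * (\<Sum>i\<in>I. (F i (x r) - F i (y r)) * (x r i - y r i))) (at r within {0..T})"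
      unfolding q_def using x y r by (intro sum_squares_deriv DERIV_diff) auto
    have "(\<Sum>i\<in>I. (F i (x r) - F i (y r)) * (x r i - y r i))
        \<le> (\<Sum>i\<in>I. (L * (\<Sum>j\<in>I. \<bar>x r j - y r j\<bar>)) * \<bar>x r i - y r i\<bar>)"
    proof (rule sum_mono)
      fix i assume i: "i \<in> I"
      have "(F i (x r) - F i (y r)) * (x r i - y r i) \<le> \<bar>F i (x r) - F i (y r)\<bar> * \<bar>x r i - y r i\<bar>"
        by (metis abs_ge_self abs_mult)
      also have "\<dots> \<le> (L * (\<Sum>j\<in>I. \<bar>x r j - y r j\<bar>)) * \<bar>x r i - y r i\<bar>"
        using M r i by (intro mult_right_mono lip) (auto simp: le_max_iff_disj)
      finally show "(F i (x r) - F i (y r)) * (x r i - y r i) \<le> \<dots>" .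
    qed
    also have "\<dots> = L * (\<Sum>j\<in>I. \<bar>x r j - y r j\<bar>)\<^sup>2"
      by (simp add: power2_eq_square mult.assoc flip: sum_distrib_left)
    also have "\<dots> \<le> L * (card I * q r)"
      using L Cauchy_Schwarz_ineq_sum[of "\<lambda>_. 1" "\<lambda>j. \<bar>x r j - y r j\<bar>" I]
      by (intro mult_left_mono) (auto simp: q_def)
    finally show "2 * (\<Sum>i\<in>I. (F i (x r) - F i (y r)) * (x r i - y r i)) \<le> 2 * L * card I * q r"
      by simp
  qed
  moreover have "q 0 = 0" by (simp add: q_def init)
  ultimately have "q t \<le> 0" by simp
  moreover have "(x t i - y t i)\<^sup>2 \<le> q t"
    unfolding q_def using i I by (intro member_le_sum[where f = "\<lambda>i. (x t i - y t i)\<^sup>2"]) auto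
  ultimately have "(x t i - y t i)\<^sup>2 \<le> 0" by linarith
  thus ?thesis by simp
qed

section \<open>Smooth functions on the plane\<close>

lemma has_real_derivative_partial_x:
  assumes "f differentiable (at (x, y))"
  shows "((\<lambda>s. f (s, y)) has_real_derivative partial_x f (x, y)) (at x)"
proof -
  have "(\<lambda>s. (s, y)) differentiable (at x)"
    unfolding differentiable_def by (rule exI) (rule derivative_eq_intros refl)+
  hence "(\<lambda>s. f (s, y)) differentiable (at x)"
    using differentiable_chain_at[of "\<lambda>s. (s, y)" x f] assms by (simp add: o_def)
  thus ?thesis
    by (simp add: partial_x_def DERIV_deriv_iff_real_differentiable)
qed

lemma has_real_derivative_partial_y:
  assumes "f differentiable (at (x, y))"
  shows "((\<lambda>s. f (x, s)) has_real_derivative partial_y f (x, y)) (at y)"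
proof -
  have "(\<lambda>s. (x, s)) differentiable (at y)"
    unfolding differentiable_def by (rule exI) (rule derivative_eq_intros refl)+
  hence "(\<lambda>s. f (x, s)) differentiable (at y)"
    using differentiable_chain_at[of "\<lambda>s. (x, s)" y f] assms by (simp add: o_def)
  thus ?thesis
    by (simp add: partial_y_def DERIV_deriv_iff_real_differentiable)
qed

lemma partial_x_eqI:
  "(\<And>x y. ((\<lambda>s. f (s, y)) has_real_derivative g (x, y)) (at x)) \<Longrightarrow> partial_x f = g"
  by (auto simp: partial_x_def fun_eq_iff intro: DERIV_imp_deriv)

lemma partial_y_eqI:
  "(\<And>x y. ((\<lambda>s. f (x, s)) has_real_derivative g (x, y)) (at y)) \<Longrightarrow> partial_y f = g"
  by (auto simp: partial_y_def fun_eq_iff intro: DERIV_imp_deriv)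

lemma partial_add:
  assumes "\<And>z. f differentiable (at z)" "\<And>z. g differentiable (at z)"
  shows "partial_x (\<lambda>z. f z + g z) = (\<lambda>z. partial_x f z + partial_x g z)"
    and "partial_y (\<lambda>z. f z + g z) = (\<lambda>z. partial_y f z + partial_y g z)"
proof -
  show "partial_x (\<lambda>z. f z + g z) = (\<lambda>z. partial_x f z + partial_x g z)"
    by (intro partial_x_eqI DERIV_add has_real_derivative_partial_x assms)
  show "partial_y (\<lambda>z. f z + g z) = (\<lambda>z. partial_y f z + partial_y g z)"
    by (intro partial_y_eqI DERIV_add has_real_derivative_partial_y assms)
qed

lemma partial_mult:
  assumes "\<And>z. f differentiable (at z)" "\<And>z. g differentiable (at z)"
  shows "partial_x (\<lambda>z. f z * g z) = (\<lambda>z. partial_x f z * g z + f z * partial_x g z)"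
    and "partial_y (\<lambda>z. f z * g z) = (\<lambda>z. partial_y f z * g z + f z * partial_y g z)"
proof -
  note dx = has_real_derivative_partial_x[OF assms(1)] has_real_derivative_partial_x[OF assms(2)]
  note dy = has_real_derivative_partial_y[OF assms(1)] has_real_derivative_partial_y[OF assms(2)]
  show "partial_x (\<lambda>z. f z * g z) = (\<lambda>z. partial_x f z * g z + f z * partial_x g z)"
    using DERIV_mult[OF dx] by (intro partial_x_eqI) (simp add: algebra_simps)
  show "partial_y (\<lambda>z. f z * g z) = (\<lambda>z. partial_y f z * g z + f z * partial_y g z)"
    using DERIV_mult[OF dy] by (intro partial_y_eqI) (simp add: algebra_simps)
qed

lemma partial_const: "partial_x (\<lambda>z. c) = (\<lambda>z. 0)" "partial_y (\<lambda>z. c) = (\<lambda>z. 0)"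
  by (auto intro!: partial_x_eqI partial_y_eqI)

lemma C_diff_Suc_D: "C_diff (Suc k) f \<Longrightarrow> C_diff k f"
proof (induction k arbitrary: f)
  case 0
  thus ?case
    by (auto intro!: continuous_at_imp_continuous_on differentiable_imp_continuous_within)
next
  case (Suc k)
  have *: "\<forall>z. f differentiable (at z)" "C_diff (Suc k) (partial_x f)" "C_diff (Suc k) (partial_y f)"
    using Suc.prems unfolding C_diff.simps(2)[of "Suc k"] by blast+
  from *(1) Suc.IH[OF *(2)] Suc.IH[OF *(3)] show ?case by simp
qed

lemma C_diff_add: "C_diff k f \<Longrightarrow> C_diff k g \<Longrightarrow> C_diff k (\<lambda>z. f z + g z)"
proof (induction k arbitrary: f g)
  case 0
  thus ?case by (auto intro: continuous_on_add)
next
  case (Suc k)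
  thus ?case by (simp add: partial_add[of f g] del: split_paired_All)
qed

lemma C_diff_mult: "C_diff k f \<Longrightarrow> C_diff k g \<Longrightarrow> C_diff k (\<lambda>z. f z * g z)"
proof (induction k arbitrary: f g)
  case 0
  thus ?case by (auto intro: continuous_on_mult)
next
  case (Suc k)
  thus ?case using C_diff_Suc_D[OF Suc.prems(1)] C_diff_Suc_D[OF Suc.prems(2)]
    by (simp add: partial_mult[of f g] C_diff_add del: split_paired_All)
qed

text \<open>Smoothness is coinductive: it suffices to exhibit a class of differentiable functions that is closed
  under both partial derivatives.\<close>

lemma smooth_coinduct:
  assumes "f \<in> A"
    and "\<And>f. f \<in> A \<Longrightarrow> (\<forall>z. f differentiable (at z)) \<and> partial_x f \<in> A \<and> partial_y f \<in> A"
  shows "smooth f"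
proof -
  have "C_diff k f" if "f \<in> A" for k f
    using that
  proof (induction k arbitrary: f)
    case 0
    thus ?case using assms(2)
      by (auto intro!: continuous_at_imp_continuous_on differentiable_imp_continuous_within)
  qed (use assms(2) in auto)
  thus ?thesis using assms(1) by (simp add: smooth_def)
qed

lemma smooth_differentiable: "smooth f \<Longrightarrow> f differentiable (at z)"
  unfolding smooth_def by (drule spec[of _ "Suc 0"]) (cases z, simp)

lemma smooth_continuous_on: "smooth f \<Longrightarrow> continuous_on S f"
  unfolding smooth_def by (drule spec[of _ 0]) (auto intro: continuous_on_subset)

lemma smooth_partial:
  assumes "smooth f"
  shows "smooth (partial_x f)" and "smooth (partial_y f)"
proof -
  from assms have "C_diff (Suc k) f" for k by (simp only: smooth_def)
  thus "smooth (partial_x f)" "smooth (partial_y f)" by (auto simp: smooth_def)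
qed

lemma smooth_partial_funpow:
  "smooth f \<Longrightarrow> smooth ((partial_x ^^ i) f)" "smooth f \<Longrightarrow> smooth ((partial_y ^^ i) f)"
  by (induction i) (auto intro: smooth_partial)

lemma smooth_add: "smooth f \<Longrightarrow> smooth g \<Longrightarrow> smooth (\<lambda>z. f z + g z)"
  by (simp add: smooth_def C_diff_add)

lemma smooth_mult: "smooth f \<Longrightarrow> smooth g \<Longrightarrow> smooth (\<lambda>z. f z * g z)"
  by (simp add: smooth_def C_diff_mult)

lemma smooth_const: "smooth (\<lambda>z. c)"
  by (rule smooth_coinduct[where A = "range (\<lambda>c z. c)"]) (auto simp: partial_const)

lemma smooth_diff: "smooth f \<Longrightarrow> smooth g \<Longrightarrow> smooth (\<lambda>z. f z - g z)"
  using smooth_add[OF _ smooth_mult[OF smooth_const[of "-1"]], of f g] by simp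

lemma smooth_power: "smooth f \<Longrightarrow> smooth (\<lambda>z. f z ^ n)"
  by (induction n) (auto intro: smooth_const smooth_mult)

lemma smooth_sum: "(\<And>i. i \<in> I \<Longrightarrow> smooth (f i)) \<Longrightarrow> smooth (\<lambda>z. \<Sum>i\<in>I. f i z)"
  by (induction I rule: infinite_finite_induct) (auto intro: smooth_const smooth_add)

lemmas smooth_intros = smooth_add smooth_mult smooth_const smooth_diff smooth_power smooth_sum
  smooth_partial

lemma partial_sum:
  assumes "\<And>i. i \<in> I \<Longrightarrow> smooth (f i)"
  shows "partial_x (\<lambda>z. \<Sum>i\<in>I. f i z) = (\<lambda>z. \<Sum>i\<in>I. partial_x (f i) z)"
    and "partial_y (\<lambda>z. \<Sum>i\<in>I. f i z) = (\<lambda>z. \<Sum>i\<in>I. partial_y (f i) z)"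
proof -
  show "partial_x (\<lambda>z. \<Sum>i\<in>I. f i z) = (\<lambda>z. \<Sum>i\<in>I. partial_x (f i) z)"
    by (intro partial_x_eqI DERIV_sum)
      (rule has_real_derivative_partial_x[OF smooth_differentiable[OF assms]])
  show "partial_y (\<lambda>z. \<Sum>i\<in>I. f i z) = (\<lambda>z. \<Sum>i\<in>I. partial_y (f i) z)"
    by (intro partial_y_eqI DERIV_sum)
      (rule has_real_derivative_partial_y[OF smooth_differentiable[OF assms]])
qed

lemma partial_cmult:
  assumes "smooth f"
  shows "partial_x (\<lambda>z. c * f z) = (\<lambda>z. c * partial_x f z)"
    and "partial_y (\<lambda>z. c * f z) = (\<lambda>z. c * partial_y f z)"
  using assms by (simp_all add: partial_mult smooth_differentiable partial_const)

text \<open>One-dimensional version of the previous principle, for functions of a single coordinate. The zero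
  function must belong to the class because it is the derivative in the other coordinate.\<close>

lemma smooth_of_coordinate:
  assumes "a \<in> A" and A: "\<And>a x. a \<in> A \<Longrightarrow> \<exists>a'\<in>A. \<forall>x. (a has_real_derivative a' x) (at x)"
    and A0: "(\<lambda>x. 0) \<in> A"
  shows "smooth (\<lambda>z. a (fst z))" and "smooth (\<lambda>z. a (snd z))"
proof -
  have diff: "(\<lambda>z :: real \<times> real. a (p z)) differentiable (at z)"
    if "a \<in> A" "p = fst \<or> p = snd" for a p z
  proof -
    from A[OF that(1)] have "a differentiable (at (p z))"
      using real_differentiable_def by blast
    moreover have "p differentiable (at z)"
      using that(2) by (auto intro!: bounded_linear_imp_differentiable bounded_linear_fst bounded_linear_snd)
    ultimately show ?thesis
      using differentiable_chain_at[of p z a] by (simp add: o_def)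
  qed
  have x: "partial_x (\<lambda>z. a (fst z)) \<in> (\<lambda>a z. a (fst z)) ` A"
    and y: "partial_y (\<lambda>z. a (snd z)) \<in> (\<lambda>a z. a (snd z)) ` A" if "a \<in> A" for a
  proof -
    from A[OF that] obtain a' where "a' \<in> A" "\<And>x. (a has_real_derivative a' x) (at x)" by blast
    hence "partial_x (\<lambda>z. a (fst z)) = (\<lambda>z. a' (fst z))" "partial_y (\<lambda>z. a (snd z)) = (\<lambda>z. a' (snd z))"
      by (auto intro!: partial_x_eqI partial_y_eqI)
    thus "partial_x (\<lambda>z. a (fst z)) \<in> (\<lambda>a z. a (fst z)) ` A"
         "partial_y (\<lambda>z. a (snd z)) \<in> (\<lambda>a z. a (snd z)) ` A"
      using \<open>a' \<in> A\<close> by auto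
  qed
  have x0: "partial_y (\<lambda>z. a (fst z)) = (\<lambda>z. 0)" "partial_x (\<lambda>z. a (snd z)) = (\<lambda>z. 0)" for a
    by (auto intro!: partial_x_eqI partial_y_eqI)
  show "smooth (\<lambda>z. a (fst z))"
    by (rule smooth_coinduct[where A = "(\<lambda>a z. a (fst z)) ` A"])
      (use assms(1) diff x x0 A0 in auto)
  show "smooth (\<lambda>z. a (snd z))"
    by (rule smooth_coinduct[where A = "(\<lambda>a z. a (snd z)) ` A"])
      (use assms(1) diff y x0 A0 in auto)
qed

lemma smooth_sin:
  "smooth (\<lambda>z. sin (k * fst z + d))" "smooth (\<lambda>z. sin (k * snd z + d))"
proof -
  let ?A = "range (\<lambda>(c, k, d) x. c * sin (k * x + d :: real))"
  have "(\<lambda>x. sin (k * x + d)) \<in> ?A" by (rule image_eqI[of _ _ "(1, k, d)"]) auto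
  moreover have "(\<lambda>x. 0) \<in> ?A" by (rule image_eqI[of _ _ "(0, 0, 0)"]) auto
  moreover have "\<exists>a'\<in>?A. \<forall>x. (a has_real_derivative a' x) (at x)" if "a \<in> ?A" for a
  proof -
    from that obtain c k d where a: "a = (\<lambda>x. c * sin (k * x + d))" by auto
    \<comment> \<open>The phase shift writes the cosine as a sine, so that one family is closed under derivatives.\<close>
    have "sin (k * x + (d + pi / 2)) = cos (k * x + d)" for x
      by (simp add: sin_add flip: add.assoc)
    hence "(a has_real_derivative (c * k) * sin (k * x + (d + pi / 2))) (at x)" for x
      unfolding a by (auto intro!: derivative_eq_intros)
    moreover have "(\<lambda>x. (c * k) * sin (k * x + (d + pi / 2))) \<in> ?A"
      by (rule image_eqI[of _ _ "(c * k, k, d + pi / 2)"]) auto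
    ultimately show ?thesis
      by (intro bexI[of _ "\<lambda>x. (c * k) * sin (k * x + (d + pi / 2))"]) auto
  qed
  ultimately show "smooth (\<lambda>z. sin (k * fst z + d))" "smooth (\<lambda>z. sin (k * snd z + d))"
    using smooth_of_coordinate[of "\<lambda>x. sin (k * x + d)" ?A] by blast+
qed

text \<open>All derivatives of the function \<open>exp (- 1/x)\<close>, extended by 0 to \<open>x \<le> 0\<close>, have this form. The bump
  functions below are built from \<open>flat 1\<close>.\<close>

definition flat :: "real poly \<Rightarrow> real \<Rightarrow> real" where
  "flat p x = (if x > 0 then poly p (1 / x) * exp (- (1 / x)) else 0)"

lemma poly_times_exp_neg_tendsto_0: "((\<lambda>y. poly p y * exp (- y)) \<longlongrightarrow> (0::real)) at_top"
proof -
  have "((\<lambda>y. \<Sum>i\<le>degree p. coeff p i * (y ^ i / exp y)) \<longlongrightarrow> (\<Sum>i\<le>degree p. coeff p i * 0)) at_top"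
    by (intro tendsto_intros tendsto_power_div_exp_0)
  thus ?thesis
    by (simp add: poly_altdef sum_distrib_right exp_minus divide_inverse mult.assoc)
qed

text \<open>The polynomial on the right comes from differentiating \<open>p(1/x) exp(-1/x)\<close>. At 0 the difference
  quotient from the right is \<open>y p(y) exp(-y)\<close> with \<open>y = 1/h\<close>, which tends to 0.\<close>

lemma flat_has_derivative:
  "(flat p has_real_derivative flat ([:0, 0, 1:] * (p - pderiv p)) x) (at x)"
proof -
  consider "x > 0" | "x < 0" | "x = 0" by linarith
  thus ?thesis
  proof cases
    case 1
    have "((\<lambda>x. poly p (1 / x) * exp (- (1 / x))) has_real_derivative
            flat ([:0, 0, 1:] * (p - pderiv p)) x) (at x)"
      using 1 by (auto intro!: derivative_eq_intros simp: flat_def field_simps power2_eq_square)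
    moreover have "eventually (\<lambda>x. poly p (1 / x) * exp (- (1 / x)) = flat p x) (nhds x)"
      using eventually_nhds_in_open[of "{0<..}" x] 1 by (auto elim!: eventually_mono simp: flat_def)
    ultimately show ?thesis
      by (subst (asm) DERIV_cong_ev[OF refl _ refl])
  next
    case 2
    have "((\<lambda>x. 0) has_real_derivative flat ([:0, 0, 1:] * (p - pderiv p)) x) (at x)"
      using 2 by (auto simp: flat_def)
    moreover have "eventually (\<lambda>x. 0 = flat p x) (nhds x)"
      using eventually_nhds_in_open[of "{..<0}" x] 2 by (auto elim!: eventually_mono simp: flat_def)
    ultimately show ?thesis
      by (subst (asm) DERIV_cong_ev[OF refl _ refl])
  next
    case 3
    have "((\<lambda>h. poly (pCons 0 p) (inverse h) * exp (- inverse h)) \<longlongrightarrow> 0) (at_right 0)"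
      by (rule filterlim_compose[OF poly_times_exp_neg_tendsto_0 filterlim_inverse_at_top_right])
    hence "((\<lambda>h. flat p h / h) \<longlongrightarrow> 0) (at_right 0)"
      by (rule Lim_transform_eventually)
        (auto simp: eventually_at_filter flat_def divide_inverse)
    moreover have "((\<lambda>h. flat p h / h) \<longlongrightarrow> 0) (at_left 0)"
      by (rule tendsto_eventually) (auto simp: eventually_at_filter flat_def)
    ultimately have "((\<lambda>h. flat p h / h) \<longlongrightarrow> 0) (at 0)"
      by (simp add: filterlim_split_at)
    thus ?thesis using 3 by (simp add: DERIV_def flat_def)
  qed
qed

lemma smooth_flat:
  "smooth (\<lambda>z. flat p (k * fst z + d))" "smooth (\<lambda>z. flat p (k * snd z + d))"
proof -
  let ?A = "range (\<lambda>(p, k, d) x. flat p (k * x + d))"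
  have "(\<lambda>x. flat p (k * x + d)) \<in> ?A" by (rule image_eqI[of _ _ "(p, k, d)"]) auto
  moreover have "(\<lambda>x. 0) \<in> ?A"
    by (rule image_eqI[of _ _ "(0, 0, 0)"]) (auto simp: flat_def)
  moreover have "\<exists>a'\<in>?A. \<forall>x. (a has_real_derivative a' x) (at x)" if "a \<in> ?A" for a
  proof -
    from that obtain p k d where a: "a = (\<lambda>x. flat p (k * x + d))" by auto
    define q where "q = smult k ([:0, 0, 1:] * (p - pderiv p))"
    have "(a has_real_derivative flat ([:0, 0, 1:] * (p - pderiv p)) (k * x + d) * k) (at x)" for x
      unfolding a by (rule DERIV_chain2[OF flat_has_derivative]) (auto intro!: derivative_eq_intros)
    moreover have "flat ([:0, 0, 1:] * (p - pderiv p)) (k * x + d) * k = flat q (k * x + d)" for x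
      unfolding q_def by (simp add: flat_def)
    ultimately have "\<forall>x. (a has_real_derivative flat q (k * x + d)) (at x)" by simp
    moreover have "(\<lambda>x. flat q (k * x + d)) \<in> ?A" by (rule image_eqI[of _ _ "(q, k, d)"]) auto
    ultimately show ?thesis by (intro bexI[of _ "\<lambda>x. flat q (k * x + d)"])
  qed
  ultimately show "smooth (\<lambda>z. flat p (k * fst z + d))" "smooth (\<lambda>z. flat p (k * snd z + d))"
    using smooth_of_coordinate[of "\<lambda>x. flat p (k * x + d)" ?A] by blast+
qed

section \<open>Integration over the square\<close>

lemma Omega_cbox: "Omega = cbox (0, 0) (2*pi, 2*pi)"
  by (auto simp: Omega_def cbox_Pair_eq)

lemma Omega_sets[simp]: "Omega \<in> sets lebesgue"
  by (simp add: Omega_cbox)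

lemma integrable_Omega:
  fixes f :: fn2
  assumes "continuous_on UNIV f"
  shows "integrable (lebesgue_on Omega) f"
  using continuous_imp_integrable[of "(0,0)" "(2*pi,2*pi)" f] continuous_on_subset[OF assms]
  by (simp add: Omega_cbox)

text \<open>Both orders of integration are needed: periodicity in \<open>x\<close> makes the inner integral over \<open>x\<close> vanish,
  and likewise for \<open>y\<close>.\<close>

lemma integral_Omega:
  fixes f :: fn2
  assumes "continuous_on UNIV f"
  shows "integral\<^sup>L (lebesgue_on Omega) f = integral {0..2*pi} (\<lambda>x. integral {0..2*pi} (\<lambda>y. f (x, y)))"
    and "integral\<^sup>L (lebesgue_on Omega) f = integral {0..2*pi} (\<lambda>y. integral {0..2*pi} (\<lambda>x. f (x, y)))"
proof -
  have c: "continuous_on (cbox (0,0) (2*pi,2*pi)) f"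
    using assms continuous_on_subset by blast
  have "integral\<^sup>L (lebesgue_on Omega) f = integral Omega f"
    by (rule lebesgue_integral_eq_integral[OF integrable_Omega[OF assms]]) simp
  also have "\<dots> = integral {0..2*pi} (\<lambda>x. integral {0..2*pi} (\<lambda>y. f (x, y)))"
    using integral_prod_continuous[OF c] by (simp add: Omega_cbox)
  finally show *: "integral\<^sup>L (lebesgue_on Omega) f = integral {0..2*pi} (\<lambda>x. integral {0..2*pi} (\<lambda>y. f (x, y)))" .
  show "integral\<^sup>L (lebesgue_on Omega) f = integral {0..2*pi} (\<lambda>y. integral {0..2*pi} (\<lambda>x. f (x, y)))"
    using integral_swap_continuous[of 0 0 "2*pi" "2*pi" "\<lambda>x y. f (x, y)"] c * by simp
qed

lemma integral_partial_x_eq_0: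
  assumes f: "smooth f" and per: "\<And>y. y \<in> {0..2*pi} \<Longrightarrow> f (2*pi, y) = f (0, y)"
  shows "integral\<^sup>L (lebesgue_on Omega) (partial_x f) = 0"
proof -
  have "integral {0..2*pi} (\<lambda>x. partial_x f (x, y)) = 0" if "y \<in> {0..2*pi}" for y
  proof -
    have "((\<lambda>x. partial_x f (x, y)) has_integral (f (2*pi, y) - f (0, y))) {0..2*pi}"
      using has_real_derivative_partial_x[OF smooth_differentiable[OF f]]
      by (intro fundamental_theorem_of_calculus)
        (auto simp flip: has_real_derivative_iff_has_vector_derivative intro: DERIV_subset)
    thus ?thesis using per[OF that] by (simp add: integral_unique)
  qed
  hence "integral {0..2*pi} (\<lambda>y. integral {0..2*pi} (\<lambda>x. partial_x f (x, y))) = integral {0..2*pi} (\<lambda>y. 0 :: real)"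
    by (intro integral_cong)
  thus ?thesis
    by (subst integral_Omega(2)) (auto intro!: smooth_continuous_on smooth_partial f)
qed

lemma integral_partial_y_eq_0:
  assumes f: "smooth f" and per: "\<And>x. x \<in> {0..2*pi} \<Longrightarrow> f (x, 2*pi) = f (x, 0)"
  shows "integral\<^sup>L (lebesgue_on Omega) (partial_y f) = 0"
proof -
  have "integral {0..2*pi} (\<lambda>y. partial_y f (x, y)) = 0" if "x \<in> {0..2*pi}" for x
  proof -
    have "((\<lambda>y. partial_y f (x, y)) has_integral (f (x, 2*pi) - f (x, 0))) {0..2*pi}"
      using has_real_derivative_partial_y[OF smooth_differentiable[OF f]]
      by (intro fundamental_theorem_of_calculus)
        (auto simp flip: has_real_derivative_iff_has_vector_derivative intro: DERIV_subset)
    thus ?thesis using per[OF that] by (simp add: integral_unique)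
  qed
  hence "integral {0..2*pi} (\<lambda>x. integral {0..2*pi} (\<lambda>y. partial_y f (x, y))) = integral {0..2*pi} (\<lambda>x. 0 :: real)"
    by (intro integral_cong)
  thus ?thesis
    by (subst integral_Omega(1)) (auto intro!: smooth_continuous_on smooth_partial f)
qed

lemma integration_by_parts:
  assumes f: "smooth f" and g: "smooth g"
  shows "(\<And>y. y \<in> {0..2*pi} \<Longrightarrow> f (2*pi, y) * g (2*pi, y) = f (0, y) * g (0, y)) \<Longrightarrow>
           L2_inner f (partial_x g) = - L2_inner (partial_x f) g"
    and "(\<And>x. x \<in> {0..2*pi} \<Longrightarrow> f (x, 2*pi) * g (x, 2*pi) = f (x, 0) * g (x, 0)) \<Longrightarrow>
           L2_inner f (partial_y g) = - L2_inner (partial_y f) g"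
proof -
  note c = smooth_continuous_on[OF smooth_mult[OF smooth_partial(1)[OF f] g]]
    smooth_continuous_on[OF smooth_mult[OF f smooth_partial(1)[OF g]]]
    smooth_continuous_on[OF smooth_mult[OF smooth_partial(2)[OF f] g]]
    smooth_continuous_on[OF smooth_mult[OF f smooth_partial(2)[OF g]]]
  note d = smooth_differentiable[OF f] smooth_differentiable[OF g]
  show "L2_inner f (partial_x g) = - L2_inner (partial_x f) g"
    if "\<And>y. y \<in> {0..2*pi} \<Longrightarrow> f (2*pi, y) * g (2*pi, y) = f (0, y) * g (0, y)"
    using integral_partial_x_eq_0[OF smooth_mult[OF f g] that]
    by (simp add: L2_inner_def partial_mult d integrable_Omega c)
  show "L2_inner f (partial_y g) = - L2_inner (partial_y f) g"
    if "\<And>x. x \<in> {0..2*pi} \<Longrightarrow> f (x, 2*pi) * g (x, 2*pi) = f (x, 0) * g (x, 0)"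
    using integral_partial_y_eq_0[OF smooth_mult[OF f g] that]
    by (simp add: L2_inner_def partial_mult d integrable_Omega c)
qed

section \<open>Weak derivatives of smooth functions\<close>

lemma interior_Omega: "interior Omega = {0<..<2*pi} \<times> {0<..<2*pi}"
  by (simp add: Omega_def interior_Times)

lemma test_function_smooth: "\<eta> \<in> test_functions \<Longrightarrow> smooth \<eta>"
  by (simp add: test_functions_def)

lemma test_function_boundary:
  assumes "\<eta> \<in> test_functions"
  shows "\<eta> (0, y) = 0" "\<eta> (2*pi, y) = 0" "\<eta> (x, 0) = 0" "\<eta> (x, 2*pi) = 0"
proof -
  have "\<eta> z = 0" if "z \<notin> interior Omega" for z
  proof (rule ccontr)
    assume "\<eta> z \<noteq> 0"
    hence "z \<in> closure {z. \<eta> z \<noteq> 0}"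
      by (intro closure_subset[THEN subsetD]) simp
    thus False using assms that by (auto simp: test_functions_def)
  qed
  thus "\<eta> (0, y) = 0" "\<eta> (2*pi, y) = 0" "\<eta> (x, 0) = 0" "\<eta> (x, 2*pi) = 0"
    by (auto simp: interior_Omega)
qed

lemma partial_eq_0_off_support:
  assumes "z \<notin> closure {z. f z \<noteq> 0}"
  shows "partial_x f z = 0" "partial_y f z = 0"
proof -
  obtain x y where z: "z = (x, y)" by force
  define U where "U = - closure {z. f z \<noteq> 0}"
  have U: "open U" "(x, y) \<in> U" using assms by (auto simp: U_def z)
  have f0: "f w = 0" if "w \<in> U" for w
    using that closure_subset[of "{z. f z \<noteq> 0}"] by (auto simp: U_def)
  have "open ((\<lambda>s. (s, y)) -` U)" "open ((\<lambda>s. (x, s)) -` U)"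
    using U(1) by (auto intro!: open_vimage continuous_intros)
  hence "eventually (\<lambda>s. (s, y) \<in> U) (nhds x)" "eventually (\<lambda>s. (x, s) \<in> U) (nhds y)"
    using U(2) by (auto simp: eventually_nhds)
  hence "eventually (\<lambda>s. f (s, y) = 0) (nhds x)" "eventually (\<lambda>s. f (x, s) = 0) (nhds y)"
    by (auto elim!: eventually_mono simp: f0)
  hence "deriv (\<lambda>s. f (s, y)) x = deriv (\<lambda>s. 0) x" "deriv (\<lambda>s. f (x, s)) y = deriv (\<lambda>s. 0) y"
    by (intro deriv_cong_ev refl; simp)+
  thus "partial_x f z = 0" "partial_y f z = 0"
    by (simp_all add: z partial_x_def partial_y_def)
qed

lemma test_functions_partial:
  assumes "\<eta> \<in> test_functions"
  shows "partial_x \<eta> \<in> test_functions" "partial_y \<eta> \<in> test_functions"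
proof -
  have "closure {z. partial_x \<eta> z \<noteq> 0} \<subseteq> closure {z. \<eta> z \<noteq> 0}"
       "closure {z. partial_y \<eta> z \<noteq> 0} \<subseteq> closure {z. \<eta> z \<noteq> 0}"
    using partial_eq_0_off_support[of _ \<eta>] by (intro closure_minimal; blast)+
  thus "partial_x \<eta> \<in> test_functions" "partial_y \<eta> \<in> test_functions"
    using assms by (auto simp only: test_functions_def mem_Collect_eq smooth_partial)
qed

lemma test_functions_partial_funpow:
  assumes "\<eta> \<in> test_functions"
  shows "(partial_x ^^ i) \<eta> \<in> test_functions" "(partial_y ^^ i) \<eta> \<in> test_functions"
  by (induction i) (use assms in \<open>auto intro: test_functions_partial\<close>)

lemma integration_by_parts_funpow:
  assumes "smooth f" "\<eta> \<in> test_functions"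
  shows "L2_inner f ((partial_x ^^ i) \<eta>) = (-1) ^ i * L2_inner ((partial_x ^^ i) f) \<eta>"
    and "L2_inner f ((partial_y ^^ i) \<eta>) = (-1) ^ i * L2_inner ((partial_y ^^ i) f) \<eta>"
proof -
  show "L2_inner f ((partial_x ^^ i) \<eta>) = (-1) ^ i * L2_inner ((partial_x ^^ i) f) \<eta>"
    using assms(1)
  proof (induction i arbitrary: f)
    case (Suc i)
    let ?\<zeta> = "(partial_x ^^ i) \<eta>"
    have \<zeta>: "?\<zeta> \<in> test_functions" by (rule test_functions_partial_funpow[OF assms(2)])
    have "L2_inner f (partial_x ?\<zeta>) = - L2_inner (partial_x f) ?\<zeta>"
      by (rule integration_by_parts(1)[OF Suc.prems test_function_smooth[OF \<zeta>]])
        (simp add: test_function_boundary[OF \<zeta>])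
    thus ?case
      using Suc.IH[OF smooth_partial(1)[OF Suc.prems]] by (simp flip: funpow_swap1)
  qed simp
  show "L2_inner f ((partial_y ^^ i) \<eta>) = (-1) ^ i * L2_inner ((partial_y ^^ i) f) \<eta>"
    using assms(1)
  proof (induction i arbitrary: f)
    case (Suc i)
    let ?\<zeta> = "(partial_y ^^ i) \<eta>"
    have \<zeta>: "?\<zeta> \<in> test_functions" by (rule test_functions_partial_funpow[OF assms(2)])
    have "L2_inner f (partial_y ?\<zeta>) = - L2_inner (partial_y f) ?\<zeta>"
      by (rule integration_by_parts(2)[OF Suc.prems test_function_smooth[OF \<zeta>]])
        (simp add: test_function_boundary[OF \<zeta>])
    thus ?case
      using Suc.IH[OF smooth_partial(2)[OF Suc.prems]] by (simp flip: funpow_swap1)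
  qed simp
qed

lemma measurable_Omega: "continuous_on UNIV f \<Longrightarrow> f \<in> borel_measurable (lebesgue_on Omega)"
  for f :: fn2
  using integrable_Omega borel_measurable_integrable by blast

lemma continuous_in_L2: "continuous_on UNIV f \<Longrightarrow> f \<in> L2"
  by (auto simp: L2_def measurable_Omega intro!: integrable_Omega continuous_intros)

lemma smooth_in_L2: "smooth f \<Longrightarrow> f \<in> L2"
  by (intro continuous_in_L2 smooth_continuous_on)

lemma weak_deriv_smooth:
  assumes "smooth f"
  shows "weak_deriv i j f ((partial_y ^^ j) ((partial_x ^^ i) f))"
  using assms
  by (auto simp: weak_deriv_def smooth_in_L2 smooth_partial_funpow power_add
      integration_by_parts_funpow test_functions_partial_funpow)

lemma L2_mult_integrable:
  assumes "f \<in> L2" "g \<in> L2"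
  shows "integrable (lebesgue_on Omega) (\<lambda>z. f z * g z)"
proof (rule Bochner_Integration.integrable_bound)
  show "integrable (lebesgue_on Omega) (\<lambda>z. (f z)\<^sup>2 + (g z)\<^sup>2)"
    using assms by (auto simp: L2_def)
  show "(\<lambda>z. f z * g z) \<in> borel_measurable (lebesgue_on Omega)"
    using assms by (auto simp: L2_def)
  have "\<bar>a * b\<bar> \<le> a\<^sup>2 + b\<^sup>2" for a b :: real
  proof -
    have "0 \<le> \<bar>a\<bar> * \<bar>b\<bar>" by simp
    thus ?thesis using sum_squares_bound[of "\<bar>a\<bar>" "\<bar>b\<bar>"] by (simp only: abs_mult power2_abs)
  qed
  thus "AE z in lebesgue_on Omega. norm (f z * g z) \<le> norm ((f z)\<^sup>2 + (g z)\<^sup>2)" by simp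
qed

lemma L2_diff: "f \<in> L2 \<Longrightarrow> g \<in> L2 \<Longrightarrow> (\<lambda>z. f z - g z) \<in> L2"
  using L2_mult_integrable[of f g] by (auto simp: L2_def power2_diff mult.assoc)

lemma L2_inner_diff:
  assumes "f \<in> L2" "g \<in> L2" "h \<in> L2"
  shows "L2_inner (\<lambda>z. f z - g z) h = L2_inner f h - L2_inner g h"
  using assms by (simp add: L2_inner_def left_diff_distrib L2_mult_integrable)

text \<open>The sets over which \<open>h\<close> integrates to 0 form a Dynkin system. It contains the boxes, which generate
  the Borel sets and are stable under intersection, so \<open>h\<close> integrates to 0 over every Borel set. The
  argument is carried out for a Borel function \<open>k\<close> that agrees with \<open>h\<close> almost everywhere.\<close>

lemma integral_zero_on_boxes_imp_AE_zero:
  fixes h :: "'a::euclidean_space \<Rightarrow> real"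
  assumes h: "integrable lebesgue h" and box: "\<And>l u. (LINT x:box l u|lebesgue. h x) = 0"
  shows "AE x in lebesgue. h x = 0"
proof -
  obtain k where k[measurable]: "k \<in> borel_measurable lborel" and ae: "AE x in lborel. h x = k x"
    using completion_ex_borel_measurable_real[of h lborel] h by auto
  have ae': "AE x in lebesgue. h x = k x" by (rule AE_completion[OF ae])
  have meas: "k \<in> borel_measurable lebesgue" "h \<in> borel_measurable lebesgue"
    using measurable_completion[OF k] h by auto
  have "integrable lebesgue k"
    using h meas ae' by (subst integrable_cong_AE[of _ _ h]) (auto elim!: eventually_mono)
  hence ik: "integrable lborel k" by (simp add: integrable_completion)
  hence sik: "set_integrable lborel A k" if "A \<in> sets borel" for A
    unfolding set_integrable_def using that ik by (intro integrable_mult_indicator) auto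
  have box_k: "(LINT x:box l u|lborel. k x) = 0" for l u
  proof -
    have "(LINT x:box l u|lborel. k x) = (LINT x:box l u|lebesgue. k x)"
      unfolding set_lebesgue_integral_def by (subst integral_completion) auto
    also have "\<dots> = (LINT x:box l u|lebesgue. h x)"
      unfolding set_lebesgue_integral_def
    proof (rule integral_cong_AE)
      show "AE x in lebesgue. indicat_real (box l u) x *\<^sub>R k x = indicat_real (box l u) x *\<^sub>R h x"
        using ae' by eventually_elim simp
    next
      have "box l u \<in> sets lebesgue" by (intro sets_completionI_sets) simp
      hence ind: "indicat_real (box l u) \<in> borel_measurable lebesgue" by (rule borel_measurable_indicator)
      show "(\<lambda>x. indicat_real (box l u) x *\<^sub>R k x) \<in> borel_measurable lebesgue"
        "(\<lambda>x. indicat_real (box l u) x *\<^sub>R h x) \<in> borel_measurable lebesgue"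
        by (rule borel_measurable_scaleR[OF ind meas(1)] borel_measurable_scaleR[OF ind meas(2)])+
    qed
    also have "\<dots> = 0" by (rule box)
    finally show ?thesis .
  qed
  let ?E = "range (\<lambda>(a, b). box a b :: 'a set)"
  let ?A = "\<lambda>n::nat. box (- (real n *\<^sub>R One)) (real n *\<^sub>R One) :: 'a set"
  have UNIV_k: "integral\<^sup>L lborel k = 0"
  proof -
    have "(\<lambda>n. LINT x:?A n|lborel. k x) \<longlonglongrightarrow> (LINT x:(\<Union>n. ?A n)|lborel. k x)"
    proof (rule set_integral_cont_up)
      show "incseq ?A"
        by (intro incseq_SucI subset_box_imp(4)) simp
      show "set_integrable lborel (\<Union>n. ?A n) k" by (rule sik) auto
    qed auto
    hence "(\<lambda>n. 0 :: real) \<longlonglongrightarrow> integral\<^sup>L lborel k"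
      unfolding box_k UN_box_eq_UNIV by (simp add: set_lebesgue_integral_def)
    thus ?thesis using LIMSEQ_unique tendsto_const by blast
  qed
  have "(LINT x:A|lborel. k x) = 0" if "A \<in> sets borel" for A
  proof -
    have gen: "Int_stable ?E" "?E \<subseteq> Pow UNIV"
      by (auto simp: Int_stable_def box_Int_box)
    have borel: "sets (borel :: 'a measure) = sigma_sets UNIV ?E"
      by (simp add: borel_eq_box)
    have "A \<in> sigma_sets UNIV ?E" using that borel by simp
    thus ?thesis
    proof (induction rule: sigma_sets_induct_disjoint[OF gen, consumes 1, case_names basic empty compl union])
      case (basic A)
      thus ?case using box_k by auto
    next
      case empty
      thus ?case by (simp add: set_lebesgue_integral_def)
    next
      case (compl A)
      hence A1: "A \<in> sets borel" unfolding borel by simp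
      have A2: "UNIV - A \<in> sets borel" using sets.compl_sets[OF A1] by simp
      have "integral\<^sup>L lborel k = (LINT x:A \<union> (UNIV - A)|lborel. k x)"
        by (simp add: set_lebesgue_integral_def)
      also have "\<dots> = (LINT x:A|lborel. k x) + (LINT x:UNIV - A|lborel. k x)"
        by (intro set_integral_Un sik A1 A2) blast
      finally show ?case unfolding UNIV_k compl(2) by simp
    next
      case (union A)
      have A: "A i \<in> sets borel" for i unfolding borel using union(2) by blast
      have "(LINT x:(\<Union>i. A i)|lborel. k x) = (\<Sum>i. LINT x:A i|lborel. k x)"
        using union(1) A
        by (intro lebesgue_integral_countable_add sik) (auto simp: disjoint_family_on_def)
      thus ?case by (simp add: union)
    qed
  qed
  hence "AE x in lborel. k x = 0"
    by (intro density_unique_real) (auto simp: ik set_lebesgue_integral_def)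
  hence "AE x in lebesgue. k x = 0" by (rule AE_completion)
  thus ?thesis using ae' by eventually_elim simp
qed

lemma AE_interior_Omega: "AE z in lebesgue_on Omega. z \<in> interior Omega"
proof -
  have "Omega - interior Omega \<in> null_sets lebesgue"
    using negligible_frontier_interval[of "(0,0)" "(2*pi,2*pi) :: real \<times> real"]
    by (simp add: Omega_cbox negligible_iff_null_sets)
  hence "AE z in lebesgue. z \<in> Omega \<longrightarrow> z \<in> interior Omega"
    by (rule AE_I'[of "Omega - interior Omega"]) auto
  thus ?thesis by (simp add: AE_restrict_space_iff)
qed

text \<open>A smooth function that takes values in \<open>[0,1]\<close> and is positive exactly on the open rectangle with
  corners \<open>a\<close> and \<open>b\<close>. The arguments are written as affine functions \<open>k * s + d\<close> to match
  \<open>smooth_flat\<close>.\<close>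

definition bump :: "real \<times> real \<Rightarrow> real \<times> real \<Rightarrow> fn2" where
  "bump a b z = (flat 1 (1 * fst z + - fst a) * flat 1 (-1 * fst z + fst b)) *
                (flat 1 (1 * snd z + - snd a) * flat 1 (-1 * snd z + snd b))"

lemma smooth_bump: "smooth (bump a b)"
  unfolding bump_def[abs_def] by (intro smooth_mult smooth_flat)

lemma flat_1_bounds: "0 \<le> flat 1 x" "flat 1 x \<le> 1"
  by (auto simp: flat_def)

lemma bump_bounds: "0 \<le> bump a b z" "bump a b z \<le> 1"
  by (auto simp: bump_def intro!: mult_nonneg_nonneg mult_le_one flat_1_bounds)

lemma bump_pos_iff: "bump a b z > 0 \<longleftrightarrow> z \<in> {fst a<..<fst b} \<times> {snd a<..<snd b}"
  by (cases z) (auto simp: bump_def flat_def zero_less_mult_iff)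

text \<open>Where \<open>0 < bump \<le> 1\<close> the powers of \<open>1 - bump\<close> tend to 0, elsewhere they are 1. So smooth functions
  supported in a fixed closed rectangle approximate the indicator function without any
  mollification.\<close>

lemma bump_powers_tendsto_indicator:
  "(\<lambda>n. 1 - (1 - bump a b z) ^ n) \<longlonglongrightarrow> indicator ({fst a<..<fst b} \<times> {snd a<..<snd b}) z"
proof (cases "bump a b z > 0")
  case True
  have "(\<lambda>n. 1 - (1 - bump a b z) ^ n) \<longlonglongrightarrow> 1 - 0"
    using True bump_bounds[of a b z] by (intro tendsto_intros LIMSEQ_power_zero) auto
  thus ?thesis using True by (simp add: bump_pos_iff)
next
  case False
  hence "bump a b z = 0" using bump_bounds(1)[of a b z] by simp
  moreover have "z \<notin> {fst a<..<fst b} \<times> {snd a<..<snd b}"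
    using False by (simp only: bump_pos_iff not_False_eq_True)
  ultimately show ?thesis by (simp add: indicator_def)
qed

lemma bump_power_test_function:
  assumes "0 < fst a" "fst b < 2*pi" "0 < snd a" "snd b < 2*pi"
  shows "(\<lambda>z. 1 - (1 - bump a b z) ^ n) \<in> test_functions"
proof -
  have "closure {z. 1 - (1 - bump a b z) ^ n \<noteq> 0} \<subseteq> {fst a..fst b} \<times> {snd a..snd b}"
  proof (rule closure_minimal)
    show "{z. 1 - (1 - bump a b z) ^ n \<noteq> 0} \<subseteq> {fst a..fst b} \<times> {snd a..snd b}"
    proof
      fix z assume "z \<in> {z. 1 - (1 - bump a b z) ^ n \<noteq> 0}"
      hence "bump a b z \<noteq> 0" by auto
      hence "bump a b z > 0" using bump_bounds(1)[of a b z] by simp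
      thus "z \<in> {fst a..fst b} \<times> {snd a..snd b}" by (auto simp: bump_pos_iff)
    qed
  qed (intro closed_Times closed_atLeastAtMost)
  also have "\<dots> \<subseteq> interior Omega" using assms by (auto simp: interior_Omega)
  finally show ?thesis
    by (auto simp: test_functions_def intro!: smooth_intros smooth_bump)
qed

text \<open>The fundamental lemma of the calculus of variations on the square. Dominated convergence is used
  twice: the test functions above give that \<open>d\<close> integrates to 0 over every rectangle whose closure lies
  in the interior of the square, and exhausting the part of an arbitrary box inside the
  square by such rectangles gives the same for that box, since the boundary of the square is a null set.\<close>

lemma AE_zero_if_orthogonal_to_test_functions:
  assumes d: "d \<in> L2" and orth: "\<And>\<eta>. \<eta> \<in> test_functions \<Longrightarrow> L2_inner d \<eta> = 0"
  shows "AE z in lebesgue_on Omega. d z = 0"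
proof -
  let ?M = "lebesgue_on Omega"
  have int_d: "integrable ?M d"
    using L2_mult_integrable[OF d, of "\<lambda>_. 1"] by (simp add: continuous_in_L2)
  have [measurable]: "d \<in> borel_measurable ?M" using int_d by auto
  have ind: "(\<lambda>z. indicator A z :: real) \<in> borel_measurable ?M" if "A \<in> sets borel" for A
    using that by (intro measurable_restrict_space1 borel_measurable_indicator) auto
  have inner: "(\<integral>z. d z * indicator ({fst a<..<fst b} \<times> {snd a<..<snd b}) z \<partial>?M) = 0"
    if ab: "0 < fst a" "fst b < 2*pi" "0 < snd a" "snd b < 2*pi" for a b
  proof -
    have "(\<lambda>n. \<integral>z. d z * (1 - (1 - bump a b z) ^ n) \<partial>?M)
            \<longlonglongrightarrow> (\<integral>z. d z * indicator ({fst a<..<fst b} \<times> {snd a<..<snd b}) z \<partial>?M)"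
    proof (rule integral_dominated_convergence)
      show "integrable ?M (\<lambda>z. \<bar>d z\<bar>)" using int_d by simp
      show "(\<lambda>z. d z * (1 - (1 - bump a b z) ^ n)) \<in> borel_measurable ?M" for n
        by (rule borel_measurable_times[OF _ measurable_Omega[OF smooth_continuous_on]])
          (auto intro!: smooth_intros smooth_bump)
      show "(\<lambda>z. d z * indicator ({fst a<..<fst b} \<times> {snd a<..<snd b}) z) \<in> borel_measurable ?M"
        by (intro borel_measurable_times ind borel_open open_Times) auto
      show "AE z in ?M. (\<lambda>n. d z * (1 - (1 - bump a b z) ^ n)) \<longlonglongrightarrow>
              d z * indicator ({fst a<..<fst b} \<times> {snd a<..<snd b}) z"
        by (intro AE_I2 tendsto_mult tendsto_const bump_powers_tendsto_indicator)
      have "\<bar>1 - (1 - bump a b z) ^ n\<bar> \<le> 1" for n z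
        using bump_bounds[of a b z] power_le_one[of "1 - bump a b z" n] by simp
      thus "AE z in ?M. norm (d z * (1 - (1 - bump a b z) ^ n)) \<le> \<bar>d z\<bar>" for n
        by (auto simp: abs_mult intro!: mult_left_le)
    qed
    moreover have "(\<integral>z. d z * (1 - (1 - bump a b z) ^ n) \<partial>?M) = 0" for n
      using orth[OF bump_power_test_function[OF ab, of n]] by (simp add: L2_inner_def)
    ultimately show ?thesis by (simp add: LIMSEQ_const_iff)
  qed
  have box: "(\<integral>z. d z * indicator (box l u) z \<partial>?M) = 0" for l u
  proof -
    define \<epsilon> where "\<epsilon> = (\<lambda>n. inverse (real (Suc n)))"
    have \<epsilon>: "\<epsilon> \<longlonglongrightarrow> 0" "\<epsilon> n > 0" for n
      unfolding \<epsilon>_def by (rule LIMSEQ_inverse_real_of_nat) simp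
    define a where "a = (\<lambda>n. (max 0 (fst l) + \<epsilon> n, max 0 (snd l) + \<epsilon> n))"
    define b where "b = (\<lambda>n. (min (2*pi) (fst u) - \<epsilon> n, min (2*pi) (snd u) - \<epsilon> n))"
    define B where "B = (\<lambda>n. {fst (a n)<..<fst (b n)} \<times> {snd (a n)<..<snd (b n)})"
    have lim: "(\<lambda>n. indicator (B n) z :: real) \<longlonglongrightarrow> indicator (box l u \<inter> interior Omega) z" for z
    proof (cases "z \<in> box l u \<inter> interior Omega")
      case True
      obtain x y where z: "z = (x, y)" by force
      have "eventually (\<lambda>n. \<epsilon> n < m) sequentially" if "m > 0" for m
        using order_tendstoD(2)[OF \<epsilon>(1) that] .
      moreover from True have "x - max 0 (fst l) > 0" "y - max 0 (snd l) > 0"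
        "min (2*pi) (fst u) - x > 0" "min (2*pi) (snd u) - y > 0"
        by (auto simp: z box_def Basis_prod_def inner_prod_def interior_Omega)
      ultimately have "eventually (\<lambda>n. \<epsilon> n < x - max 0 (fst l) \<and> \<epsilon> n < y - max 0 (snd l) \<and>
          \<epsilon> n < min (2*pi) (fst u) - x \<and> \<epsilon> n < min (2*pi) (snd u) - y) sequentially"
        by (intro eventually_conj)
      hence "eventually (\<lambda>n. indicator (box l u \<inter> interior Omega) z = (indicator (B n) z :: real)) sequentially"
        by eventually_elim (use True in \<open>auto simp: B_def a_def b_def z\<close>)
      thus ?thesis by (rule Lim_transform_eventually[OF tendsto_const])
    next
      case False
      have "z \<notin> B n" for n
        using False \<epsilon>(2)[of n]
        by (cases z) (auto simp: B_def a_def b_def box_def Basis_prod_def inner_prod_def interior_Omega)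
      thus ?thesis using False by simp
    qed
    have "(\<lambda>n. \<integral>z. d z * indicator (B n) z \<partial>?M)
            \<longlonglongrightarrow> (\<integral>z. d z * indicator (box l u \<inter> interior Omega) z \<partial>?M)"
    proof (rule integral_dominated_convergence)
      show "integrable ?M (\<lambda>z. \<bar>d z\<bar>)" using int_d by simp
      show "(\<lambda>z. d z * indicator (B n) z) \<in> borel_measurable ?M" for n
        unfolding B_def by (intro borel_measurable_times ind borel_open open_Times) auto
      show "(\<lambda>z. d z * indicator (box l u \<inter> interior Omega) z) \<in> borel_measurable ?M"
        by (intro borel_measurable_times ind borel_open open_Int open_box open_interior) auto
      show "AE z in ?M. (\<lambda>n. d z * indicator (B n) z) \<longlonglongrightarrow>
              d z * indicator (box l u \<inter> interior Omega) z"
        by (intro AE_I2 tendsto_mult tendsto_const lim)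
      show "AE z in ?M. norm (d z * indicator (B n) z) \<le> \<bar>d z\<bar>" for n
        by (auto simp: indicator_def)
    qed
    moreover have "(\<integral>z. d z * indicator (B n) z \<partial>?M) = 0" for n
      unfolding B_def by (rule inner) (use \<epsilon>(2)[of n] in \<open>auto simp: a_def b_def\<close>)
    ultimately have "(\<integral>z. d z * indicator (box l u \<inter> interior Omega) z \<partial>?M) = 0"
      by (simp add: LIMSEQ_const_iff)
    also have "(\<integral>z. d z * indicator (box l u \<inter> interior Omega) z \<partial>?M) = (\<integral>z. d z * indicator (box l u) z \<partial>?M)"
    proof (rule integral_cong_AE)
      show "AE z in ?M. d z * indicator (box l u \<inter> interior Omega) z = d z * indicator (box l u) z"
        using AE_interior_Omega by eventually_elim (auto simp: indicator_def)
    qed (intro borel_measurable_times ind borel_open open_Int open_box open_interior, simp)+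
    finally show ?thesis .
  qed
  have "AE z in lebesgue. indicator Omega z *\<^sub>R d z = 0"
  proof (rule integral_zero_on_boxes_imp_AE_zero)
    show "integrable lebesgue (\<lambda>z. indicator Omega z *\<^sub>R d z)"
      using int_d by (simp add: integrable_restrict_space)
    show "(LINT z:box l u|lebesgue. indicator Omega z *\<^sub>R d z) = 0" for l u
      using box[of l u] by (simp add: integral_restrict_space set_lebesgue_integral_def mult_ac)
  qed
  thus ?thesis
    by (simp add: AE_restrict_space_iff) (auto elim!: eventually_mono)
qed

lemma weak_deriv_unique:
  assumes "weak_deriv i j f g" "weak_deriv i j f h"
  shows "AE z in lebesgue_on Omega. g z = h z"
proof -
  have L2: "g \<in> L2" "h \<in> L2" using assms by (auto simp: weak_deriv_def)
  have "AE z in lebesgue_on Omega. g z - h z = 0"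
  proof (rule AE_zero_if_orthogonal_to_test_functions[OF L2_diff[OF L2]])
    fix \<eta> assume \<eta>: "\<eta> \<in> test_functions"
    have "(-1) ^ (i + j) * L2_inner g \<eta> = (-1) ^ (i + j) * L2_inner h \<eta>"
      using assms \<eta> by (simp add: weak_deriv_def)
    thus "L2_inner (\<lambda>z. g z - h z) \<eta> = 0"
      by (simp add: L2_inner_diff L2 smooth_in_L2 test_function_smooth \<eta>)
  qed
  thus ?thesis by simp
qed

text \<open>\<open>H_norm\<close> picks weak derivatives by \<open>SOME\<close>; by uniqueness the choice can be replaced by the classical
  derivative.\<close>

lemma L2_norm_weak_deriv_smooth:
  assumes "smooth f"
  shows "L2_norm (SOME g. weak_deriv i j f g) = L2_norm ((partial_y ^^ j) ((partial_x ^^ i) f))"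
proof -
  let ?g = "SOME g. weak_deriv i j f g" and ?h = "(partial_y ^^ j) ((partial_x ^^ i) f)"
  have h: "weak_deriv i j f ?h" by (rule weak_deriv_smooth[OF assms])
  hence g: "weak_deriv i j f ?g" by (rule someI[where P = "weak_deriv i j f"])
  have [measurable]: "?g \<in> borel_measurable (lebesgue_on Omega)" "?h \<in> borel_measurable (lebesgue_on Omega)"
    using g h unfolding weak_deriv_def L2_def by blast+
  have "L2_inner ?g ?g = L2_inner ?h ?h"
    unfolding L2_inner_def
  proof (rule integral_cong_AE)
    show "AE z in lebesgue_on Omega. ?g z * ?g z = ?h z * ?h z"
      using weak_deriv_unique[OF g h] by eventually_elim simp
  qed measurable
  thus ?thesis by (simp add: L2_norm_def)
qed

lemma H_norm_smooth:
  assumes "smooth f"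
  shows "H_norm k f =
    sqrt (\<Sum>(i, j)\<in>{(i, j). i + j \<le> k}. L2_inner ((partial_y ^^ j) ((partial_x ^^ i) f))
                                         ((partial_y ^^ j) ((partial_x ^^ i) f)))"
  unfolding H_norm_def L2_norm_weak_deriv_smooth[OF assms]
  by (simp add: L2_norm_def L2_inner_def)

lemma smooth_in_H_space: "smooth f \<Longrightarrow> f \<in> H_space k"
  unfolding H_space_def using weak_deriv_smooth by blast

text \<open>The constant sequence \<open>f\<close> approximates \<open>f\<close>. That the norm of the difference is 0 is not immediate, since
  \<open>H_norm\<close> involves chosen weak derivatives of the zero function.\<close>

lemma smooth_periodic_in_H_per:
  assumes "f \<in> smooth_periodic"
  shows "f \<in> H_per k"
proof -
  have f: "smooth f" using assms by (simp add: smooth_periodic_def)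
  have 0: "(partial_y ^^ j) ((partial_x ^^ i) (\<lambda>z. 0)) = (\<lambda>z. 0)" for i j
  proof -
    have "(partial_x ^^ i) (\<lambda>z. 0) = (\<lambda>z. 0)" by (induction i) (auto simp: partial_const)
    thus ?thesis by (induction j) (auto simp: partial_const)
  qed
  have "H_norm k (\<lambda>z. f z - f z) = 0"
    using H_norm_smooth[OF smooth_const[of 0], of k] by (simp add: 0 L2_inner_def)
  thus ?thesis
    unfolding H_per_def H_closure_def using assms f
    by (auto intro!: exI[of _ "\<lambda>_. f"] smooth_in_H_space)
qed

section \<open>The sine basis\<close>

lemma L2_inner_commute: "L2_inner f g = L2_inner g f"
  by (simp add: L2_inner_def mult.commute)

lemma L2_inner_sum_left:
  assumes "\<And>i. i \<in> I \<Longrightarrow> f i \<in> L2" "g \<in> L2"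
  shows "L2_inner (\<lambda>z. \<Sum>i\<in>I. a i * f i z) g = (\<Sum>i\<in>I. a i * L2_inner (f i) g)"
proof -
  have "L2_inner (\<lambda>z. \<Sum>i\<in>I. a i * f i z) g
      = integral\<^sup>L (lebesgue_on Omega) (\<lambda>z. \<Sum>i\<in>I. a i * (f i z * g z))"
    by (simp add: L2_inner_def sum_distrib_right mult.assoc)
  also have "\<dots> = (\<Sum>i\<in>I. a i * L2_inner (f i) g)"
    using assms by (subst Bochner_Integration.integral_sum) (auto simp: L2_inner_def intro!: L2_mult_integrable)
  finally show ?thesis .
qed

lemma L2_inner_sum_right:
  assumes "\<And>i. i \<in> I \<Longrightarrow> f i \<in> L2" "g \<in> L2"
  shows "L2_inner g (\<lambda>z. \<Sum>i\<in>I. a i * f i z) = (\<Sum>i\<in>I. a i * L2_inner g (f i))"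
  using L2_inner_sum_left[OF assms] by (simp add: L2_inner_commute)

lemma L2_inner_add_right:
  assumes "f \<in> L2" "g \<in> L2" "h \<in> L2"
  shows "L2_inner h (\<lambda>z. f z + g z) = L2_inner h f + L2_inner h g"
  using assms by (simp add: L2_inner_def distrib_left L2_mult_integrable)

definition modes :: "nat \<Rightarrow> (nat \<times> nat) set" where
  "modes N = {1..2*N} \<times> {1..2*N}"

definition sine :: "nat \<times> nat \<Rightarrow> fn2" where
  "sine k z = sin (real (fst k) * fst z) * sin (real (snd k) * snd z)"

definition sine_sum :: "nat \<Rightarrow> (nat \<times> nat \<Rightarrow> real) \<Rightarrow> fn2" where
  "sine_sum N c z = (\<Sum>k\<in>modes N. c k * sine k z)"

lemma finite_modes[simp]: "finite (modes N)"
  by (simp add: modes_def)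

lemma S_space_eq: "S_space N = range (sine_sum N)"
proof -
  define comb where "comb = (\<lambda>c (x, y). \<Sum>k1\<in>{1..2*N}. \<Sum>k2\<in>{1..2*N}.
    c k1 k2 * (sin (real k1 * x) * sin (real k2 * y)))"
  have comb: "comb c = sine_sum N (case_prod c)" for c
    by (auto simp: comb_def fun_eq_iff sine_sum_def modes_def sine_def sum.cartesian_product
        intro!: sum.cong)
  have "S_space N = range comb"
    by (auto simp: S_space_def comb_def)
  also have "\<dots> = range (sine_sum N)"
  proof (intro equalityI subsetI)
    fix f assume "f \<in> range (sine_sum N)"
    then obtain c where "f = sine_sum N c" by blast
    hence "f = comb (curry c)" by (simp add: comb)
    thus "f \<in> range comb" by blast
  qed (auto simp: comb)
  finally show ?thesis .
qed

lemma smooth_sine: "smooth (sine k)"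
  using smooth_mult[OF smooth_sin(1)[of "real (fst k)" 0] smooth_sin(2)[of "real (snd k)" 0]]
  by (simp add: sine_def[abs_def])

lemma sine_sum_eq: "sine_sum N c = (\<lambda>z. \<Sum>k\<in>modes N. c k * sine k z)"
  by (simp add: fun_eq_iff sine_sum_def)

lemma smooth_sine_sum: "smooth (sine_sum N c)"
  unfolding sine_sum_eq by (intro smooth_intros smooth_sine)

lemma sine_in_L2[simp]: "sine k \<in> L2"
  by (rule smooth_in_L2[OF smooth_sine])

lemma sine_sum_in_L2[simp]: "sine_sum N c \<in> L2"
  by (rule smooth_in_L2[OF smooth_sine_sum])

lemma sin_period_2pi: "sin (real n * (x + 2 * pi)) = sin (real n * x)"
proof -
  have "real n * (x + 2 * pi) = real n * x + 2 * real n * pi" by (simp add: algebra_simps)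
  thus ?thesis by (simp only: sin_add) simp
qed

lemma sine_sum_smooth_periodic: "sine_sum N c \<in> smooth_periodic"
  by (simp add: smooth_periodic_def smooth_sine_sum) (simp add: sine_sum_def sine_def sin_period_2pi)

lemma sine_sum_boundary:
  "sine_sum N c (0, y) = 0" "sine_sum N c (2*pi, y) = 0"
  "sine_sum N c (x, 0) = 0" "sine_sum N c (x, 2*pi) = 0"
proof -
  have "sin (real n * (2 * pi)) = 0" for n using sin_period_2pi[of n 0] by simp
  thus "sine_sum N c (0, y) = 0" "sine_sum N c (2*pi, y) = 0"
    "sine_sum N c (x, 0) = 0" "sine_sum N c (x, 2*pi) = 0"
    by (simp_all add: sine_sum_def sine_def)
qed

lemma sine_sum_diff: "sine_sum N (\<lambda>k. a k - b k) z = sine_sum N a z - sine_sum N b z"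
  by (simp add: sine_sum_def left_diff_distrib sum_subtractf)

lemma integral_cos_multiple:
  fixes m :: real
  assumes "m \<noteq> 0" "sin (m * (2 * pi)) = 0"
  shows "((\<lambda>x. cos (m * x)) has_integral 0) {0..2*pi}"
proof -
  have "((\<lambda>x. cos (m * x)) has_integral (sin (m * (2*pi)) / m - sin (m * 0) / m)) {0..2*pi}"
    using assms by (intro fundamental_theorem_of_calculus)
      (auto intro!: derivative_eq_intros simp flip: has_real_derivative_iff_has_vector_derivative)
  thus ?thesis using assms by simp
qed

lemma integral_sin_sin:
  assumes "m \<ge> 1" "n \<ge> 1"
  shows "integral {0..2*pi} (\<lambda>x. sin (real m * x) * sin (real n * x)) = (if m = n then pi else 0)"
proof -
  have s: "sin (real k * (2 * pi)) = 0" "cos (real k * (2 * pi)) = 1" for k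
    using sin_2npi[of k] cos_2npi[of k] by (simp_all add: mult_ac)
  have sum: "((\<lambda>x. cos ((real m + real n) * x)) has_integral 0) {0..2*pi}"
    using assms s(1)[of "m + n"] by (intro integral_cos_multiple) auto
  have diff: "((\<lambda>x. cos ((real m - real n) * x)) has_integral (if m = n then 2 * pi else 0)) {0..2*pi}"
  proof (cases "m = n")
    case True
    thus ?thesis using has_integral_const_real[of "1::real" 0 "2*pi"] by simp
  next
    case False
    hence "((\<lambda>x. cos ((real m - real n) * x)) has_integral 0) {0..2*pi}"
      using s[of m] s[of n] by (intro integral_cos_multiple) (simp_all add: left_diff_distrib sin_diff)
    thus ?thesis using False by simp
  qed
  have eq: "sin (real m * x) * sin (real n * x) = (cos ((real m - real n) * x) - cos ((real m + real n) * x)) / 2"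
    for x by (simp add: algebra_simps cos_diff cos_add)
  have "((\<lambda>x. sin (real m * x) * sin (real n * x)) has_integral ((if m = n then 2 * pi else 0) - 0) / 2) {0..2*pi}"
    unfolding eq by (intro has_integral_divide has_integral_diff diff sum)
  thus ?thesis by (auto dest!: integral_unique)
qed

lemma sine_orthogonal:
  assumes "k \<in> modes N" "l \<in> modes N"
  shows "L2_inner (sine k) (sine l) = (if k = l then pi\<^sup>2 else 0)"
proof -
  have "L2_inner (sine k) (sine l) = integral {0..2*pi} (\<lambda>x. integral {0..2*pi} (\<lambda>y.
          (sin (real (fst k) * x) * sin (real (fst l) * x)) * (sin (real (snd k) * y) * sin (real (snd l) * y))))"
    unfolding L2_inner_def
    by (subst integral_Omega(1)[OF smooth_continuous_on[OF smooth_mult[OF smooth_sine smooth_sine]]])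
      (simp add: sine_def mult_ac)
  also have "\<dots> = (if k = l then pi\<^sup>2 else 0)"
    using assms
    by (cases k; cases l) (auto simp: integral_sin_sin modes_def power2_eq_square)
  finally show ?thesis .
qed

lemma L2_inner_sine_sum_sine:
  assumes "l \<in> modes N"
  shows "L2_inner (sine_sum N c) (sine l) = pi\<^sup>2 * c l"
proof -
  have "L2_inner (sine_sum N c) (sine l) = (\<Sum>k\<in>modes N. c k * L2_inner (sine k) (sine l))"
    unfolding sine_sum_eq by (rule L2_inner_sum_left) auto
  also have "\<dots> = (\<Sum>k\<in>modes N. if k = l then pi\<^sup>2 * c l else 0)"
    using assms by (intro sum.cong) (auto simp: sine_orthogonal)
  also have "\<dots> = pi\<^sup>2 * c l" using assms by simp
  finally show ?thesis .
qed

lemma L2_inner_sine_sum: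
  "L2_inner (sine_sum N c) (sine_sum N d) = pi\<^sup>2 * (\<Sum>k\<in>modes N. c k * d k)"
proof -
  have "L2_inner (sine_sum N c) (sine_sum N d) = (\<Sum>k\<in>modes N. d k * L2_inner (sine_sum N c) (sine k))"
    unfolding sine_sum_eq[of N d] by (rule L2_inner_sum_right) auto
  also have "\<dots> = pi\<^sup>2 * (\<Sum>k\<in>modes N. c k * d k)"
    by (simp add: L2_inner_sine_sum_sine sum_distrib_left mult_ac)
  finally show ?thesis .
qed

definition eigenvalue :: "nat \<times> nat \<Rightarrow> real" where
  "eigenvalue k = (real (fst k))\<^sup>2 + (real (snd k))\<^sup>2"

lemma laplacian_sine: "laplacian (sine k) = (\<lambda>z. - eigenvalue k * sine k z)"
proof -
  define m n where "m = real (fst k)" and "n = real (snd k)"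
  have s: "sine k = (\<lambda>z. sin (m * fst z) * sin (n * snd z))"
    by (simp add: fun_eq_iff sine_def m_def n_def)
  have "partial_x (sine k) = (\<lambda>z. m * cos (m * fst z) * sin (n * snd z))"
       "partial_y (sine k) = (\<lambda>z. n * sin (m * fst z) * cos (n * snd z))"
    unfolding s
    by (rule partial_x_eqI partial_y_eqI, auto intro!: derivative_eq_intros)+
  hence "partial_x (partial_x (sine k)) = (\<lambda>z. - (m\<^sup>2) * sine k z)"
        "partial_y (partial_y (sine k)) = (\<lambda>z. - (n\<^sup>2) * sine k z)"
    unfolding s
    by (simp_all only:)
      (rule partial_x_eqI partial_y_eqI, auto intro!: derivative_eq_intros simp: power2_eq_square)+
  thus ?thesis
    by (simp add: fun_eq_iff laplacian_def eigenvalue_def m_def n_def algebra_simps)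
qed

lemma laplacian_sine_sum: "laplacian (sine_sum N c) = sine_sum N (\<lambda>k. - eigenvalue k * c k)"
proof -
  have sm: "smooth (\<lambda>z. c k * g z)" if "smooth g" for g k
    using that by (intro smooth_intros)
  have "partial_x (partial_x (sine_sum N c)) = (\<lambda>z. \<Sum>k\<in>modes N. c k * partial_x (partial_x (sine k)) z)"
       "partial_y (partial_y (sine_sum N c)) = (\<lambda>z. \<Sum>k\<in>modes N. c k * partial_y (partial_y (sine k)) z)"
    unfolding sine_sum_eq
    by (simp_all add: partial_sum partial_cmult sm smooth_sine smooth_partial)
  moreover have "partial_x (partial_x (sine k)) z + partial_y (partial_y (sine k)) z = - eigenvalue k * sine k z" for k z
    using fun_cong[OF laplacian_sine[of k], of z] by (simp add: laplacian_def)
  ultimately show ?thesis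
    by (simp add: laplacian_def sine_sum_eq fun_eq_iff mult_ac flip: sum.distrib distrib_left)
qed

text \<open>By orthogonality of the basis, the projection has the Fourier coefficients of \<open>f\<close>. Testing with a
  single basis function shows that no other element of the space is admissible.\<close>

lemma P_proj_eq:
  assumes "f \<in> L2"
  shows "P_proj N f = sine_sum N (\<lambda>k. L2_inner f (sine k) / pi\<^sup>2)"
  unfolding P_proj_def
proof (rule the_equality)
  let ?p = "sine_sum N (\<lambda>k. L2_inner f (sine k) / pi\<^sup>2)"
  have orth: "L2_inner (\<lambda>z. f z - p z) (sine_sum N d) =
      (\<Sum>k\<in>modes N. d k * (L2_inner f (sine k) - L2_inner p (sine k)))"
    if "p \<in> L2" for p d
    unfolding sine_sum_eq
    using assms that by (simp add: L2_inner_sum_right L2_diff L2_inner_diff)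
  show "?p \<in> S_space N \<and> (\<forall>v\<in>S_space N. L2_inner (\<lambda>z. f z - ?p z) v = 0)"
    by (auto simp: S_space_eq orth L2_inner_sine_sum_sine)
  fix p assume p: "p \<in> S_space N \<and> (\<forall>v\<in>S_space N. L2_inner (\<lambda>z. f z - p z) v = 0)"
  then obtain c where c: "p = sine_sum N c" by (auto simp: S_space_eq)
  have "c k = L2_inner f (sine k) / pi\<^sup>2" if k: "k \<in> modes N" for k
  proof -
    have "L2_inner (\<lambda>z. f z - p z) (sine_sum N (\<lambda>l. if l = k then 1 else 0)) = 0"
      using p by (auto simp: S_space_eq)
    hence "L2_inner f (sine k) - L2_inner p (sine k) = 0"
      using k by (subst (asm) orth) (auto simp: c if_distrib[of "\<lambda>x. x * _"] cong: if_cong)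
    thus ?thesis using k by (simp add: c L2_inner_sine_sum_sine)
  qed
  thus "p = ?p" by (auto simp: c fun_eq_iff sine_sum_def)
qed

section \<open>The discrete sine transform\<close>

text \<open>The sum is the real part of the sum of the powers of an \<open>M\<close>-th root of unity different from 1.\<close>

lemma sum_cos_grid:
  assumes "0 < j" "j < M"
  shows "(\<Sum>p<M. cos (2 * pi * real j * real p / real M)) = 0"
proof -
  define w where "w = cis (2 * pi * real j / real M)"
  have "real M * (2 * pi * real j / real M) = 2 * real j * pi"
    using assms by simp
  hence "w ^ M = cis (2 * real j * pi)"
    by (simp only: w_def Complex.DeMoivre)
  hence wM: "w ^ M = 1" by (simp add: complex_eq_iff)
  have "w \<noteq> 1"
  proof
    assume "w = 1"
    hence "cos (2 * pi * real j / real M) = 1" by (simp add: w_def complex_eq_iff)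
    then obtain n :: int where n: "2 * pi * real j / real M = real_of_int n * 2 * pi"
      by (auto simp: cos_one_2pi_int)
    hence "real j = real_of_int n * real M" using assms by (simp add: field_simps)
    hence jn: "int j = n * int M" by (metis of_int_eq_iff of_int_mult of_int_of_nat_eq)
    hence "int M dvd int j" by simp
    thus False using assms by (auto dest: zdvd_imp_le)
  qed
  hence "(\<Sum>p<M. w ^ p) = 0" using geometric_sum[of w M] wM by simp
  hence "(\<Sum>p<M. Re (w ^ p)) = 0" by (metis Re_sum zero_complex.sel(1))
  thus ?thesis by (simp add: w_def Complex.DeMoivre mult_ac)
qed

text \<open>The product of sines is half the difference of two cosines, of frequencies \<open>\<bar>m - n\<bar> < M\<close> and
  \<open>m + n \<le> 4 * N < M\<close>. The number \<open>4 * N + 1\<close> of grid points is the smallest that excludes aliasing of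
  the frequencies \<open>m + n\<close>.\<close>

lemma sum_sin_sin_grid:
  assumes m: "m \<in> {1..2*N}" and n: "n \<in> {1..2*N}" and M: "M = 4 * N + 1"
  shows "(\<Sum>p<M. sin (real m * (2 * pi * real p / real M)) * sin (real n * (2 * pi * real p / real M)))
       = (if m = n then real M / 2 else 0)"
proof -
  define d where "d = (if m \<le> n then n - m else m - n)"
  have d: "real d = \<bar>real m - real n\<bar>" by (auto simp: d_def of_nat_diff)
  have c: "cos ((real m - real n) * x) = cos (real d * x)" for x
    using cos_abs_real[of "(real m - real n) * x"] cos_abs_real[of "real d * x"]
    by (simp only: abs_mult d abs_idempotent)
  have eq: "sin (real m * x) * sin (real n * x) = (cos (real d * x) - cos (real (m + n) * x)) / 2" for x
    unfolding c[symmetric] by (simp add: algebra_simps cos_diff cos_add)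
  have "(\<Sum>p<M. sin (real m * (2 * pi * real p / real M)) * sin (real n * (2 * pi * real p / real M)))
      = ((\<Sum>p<M. cos (2 * pi * real d * real p / real M)) - (\<Sum>p<M. cos (2 * pi * real (m + n) * real p / real M))) / 2"
    unfolding eq by (simp add: sum_subtractf mult_ac flip: sum_divide_distrib)
  also have "(\<Sum>p<M. cos (2 * pi * real (m + n) * real p / real M)) = 0"
    using m n M by (intro sum_cos_grid) auto
  also have "(\<Sum>p<M. cos (2 * pi * real d * real p / real M)) = (if m = n then real M else 0)"
  proof (cases "m = n")
    case False
    thus ?thesis using m n M by (subst sum_cos_grid) (auto simp: d_def)
  qed (simp add: d_def)
  finally show ?thesis by (cases "m = n") simp_all
qed

definition grid :: "nat \<Rightarrow> nat \<times> nat \<Rightarrow> real \<times> real" where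
  "grid N p = (2 * pi * real (fst p) / real (4 * N + 1), 2 * pi * real (snd p) / real (4 * N + 1))"

text \<open>The coefficients of an element of \<open>S_space N\<close> as finite linear combinations of its values on a uniform
  grid. Unlike the integrals that define Fourier coefficients, such combinations inherit
  differentiability in time from the point values.\<close>

definition sine_transform :: "nat \<Rightarrow> fn2 \<Rightarrow> nat \<times> nat \<Rightarrow> real" where
  "sine_transform N f k =
     (\<Sum>p\<in>{..<4*N+1} \<times> {..<4*N+1}. (2 / real (4*N+1))\<^sup>2 * sine k (grid N p) * f (grid N p))"

lemma sine_transform_sine:
  assumes "k \<in> modes N" "l \<in> modes N"
  shows "sine_transform N (sine l) k = (if k = l then 1 else 0)"
proof -
  define M where "M = 4 * N + 1"
  have M: "real M > 0" by (simp add: M_def)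
  define s where "s = (\<lambda>m (p::nat). sin (real m * (2 * pi * real p / real M)))"
  have "sine_transform N (sine l) k = (\<Sum>p<M. \<Sum>q<M. (2 / real M)\<^sup>2 *
          ((s (fst k) p * s (fst l) p) * (s (snd k) q * s (snd l) q)))"
    unfolding sine_transform_def sum.cartesian_product M_def
    by (intro sum.cong) (auto simp: sine_def grid_def s_def M_def)
  also have "\<dots> = (2 / real M)\<^sup>2 * ((\<Sum>p<M. s (fst k) p * s (fst l) p) * (\<Sum>q<M. s (snd k) q * s (snd l) q))"
    by (simp only: sum_product) (simp only: sum_distrib_left)
  also have "(\<Sum>p<M. s (fst k) p * s (fst l) p) = (if fst k = fst l then real M / 2 else 0)"
    unfolding s_def using assms by (intro sum_sin_sin_grid[OF _ _ M_def]) (auto simp: modes_def)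
  also have "(\<Sum>q<M. s (snd k) q * s (snd l) q) = (if snd k = snd l then real M / 2 else 0)"
    unfolding s_def using assms by (intro sum_sin_sin_grid[OF _ _ M_def]) (auto simp: modes_def)
  also have "(2 / real M)\<^sup>2 * ((if fst k = fst l then real M / 2 else 0) * (if snd k = snd l then real M / 2 else 0))
      = (if k = l then 1 else 0)"
    using M by (simp add: prod_eq_iff power2_eq_square)
  finally show ?thesis .
qed

lemma sine_transform_sine_sum:
  assumes "k \<in> modes N"
  shows "sine_transform N (sine_sum N c) k = c k"
proof -
  have "sine_transform N (sine_sum N c) k = (\<Sum>l\<in>modes N. c l * sine_transform N (sine l) k)"
    unfolding sine_transform_def sine_sum_def sum_distrib_left
    by (subst sum.swap) (simp add: mult_ac)
  also have "\<dots> = (\<Sum>l\<in>modes N. if l = k then c k else 0)"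
    using assms by (intro sum.cong) (auto simp: sine_transform_sine)
  also have "\<dots> = c k" using assms by simp
  finally show ?thesis .
qed

lemma sine_sum_sine_transform: "f \<in> S_space N \<Longrightarrow> sine_sum N (sine_transform N f) = f"
  by (auto simp: S_space_eq sine_sum_def fun_eq_iff sine_transform_sine_sum)

section \<open>Functions that are Lipschitz on bounded sets\<close>

lemma lipschitz_on_bounded_const: "lipschitz_on_bounded I (\<lambda>c. a)"
  unfolding lipschitz_on_bounded_def by (intro allI exI[of _ 0]) simp

lemma lipschitz_on_bounded_coordinate:
  assumes "finite I" "i \<in> I"
  shows "lipschitz_on_bounded I (\<lambda>c. c i)"
proof -
  have "\<bar>a i - b i\<bar> \<le> 1 * (\<Sum>i\<in>I. \<bar>a i - b i\<bar>)" for a b :: "'a \<Rightarrow> real"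
    using assms member_le_sum[of i I "\<lambda>i. \<bar>a i - b i\<bar>"] by simp
  thus ?thesis unfolding lipschitz_on_bounded_def by blast
qed

lemma lipschitz_on_bounded_add:
  assumes f: "lipschitz_on_bounded I f" and g: "lipschitz_on_bounded I g"
  shows "lipschitz_on_bounded I (\<lambda>c. f c + g c)"
  unfolding lipschitz_on_bounded_def
proof
  fix M
  obtain K L where
    K: "\<And>a b. \<forall>i\<in>I. \<bar>a i\<bar> \<le> M \<Longrightarrow> \<forall>i\<in>I. \<bar>b i\<bar> \<le> M \<Longrightarrow> \<bar>f a - f b\<bar> \<le> K * (\<Sum>i\<in>I. \<bar>a i - b i\<bar>)" and
    L: "\<And>a b. \<forall>i\<in>I. \<bar>a i\<bar> \<le> M \<Longrightarrow> \<forall>i\<in>I. \<bar>b i\<bar> \<le> M \<Longrightarrow> \<bar>g a - g b\<bar> \<le> L * (\<Sum>i\<in>I. \<bar>a i - b i\<bar>)"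
    using f g unfolding lipschitz_on_bounded_def by blast
  have "\<bar>f a + g a - (f b + g b)\<bar> \<le> (K + L) * (\<Sum>i\<in>I. \<bar>a i - b i\<bar>)"
    if "\<forall>i\<in>I. \<bar>a i\<bar> \<le> M" "\<forall>i\<in>I. \<bar>b i\<bar> \<le> M" for a b
    using K[OF that] L[OF that] unfolding distrib_right by linarith
  thus "\<exists>L. \<forall>a b. (\<forall>i\<in>I. \<bar>a i\<bar> \<le> M) \<longrightarrow> (\<forall>i\<in>I. \<bar>b i\<bar> \<le> M) \<longrightarrow>
      \<bar>f a + g a - (f b + g b)\<bar> \<le> L * (\<Sum>i\<in>I. \<bar>a i - b i\<bar>)" by blast
qed

lemma lipschitz_on_bounded_mult:
  assumes f: "lipschitz_on_bounded I f" and g: "lipschitz_on_bounded I g"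
  shows "lipschitz_on_bounded I (\<lambda>c. f c * g c)"
  unfolding lipschitz_on_bounded_def
proof
  fix M :: real
  define R where "R = max M 0"
  obtain K L where
    K: "\<And>a b. \<forall>i\<in>I. \<bar>a i\<bar> \<le> R \<Longrightarrow> \<forall>i\<in>I. \<bar>b i\<bar> \<le> R \<Longrightarrow> \<bar>f a - f b\<bar> \<le> K * (\<Sum>i\<in>I. \<bar>a i - b i\<bar>)" and
    L: "\<And>a b. \<forall>i\<in>I. \<bar>a i\<bar> \<le> R \<Longrightarrow> \<forall>i\<in>I. \<bar>b i\<bar> \<le> R \<Longrightarrow> \<bar>g a - g b\<bar> \<le> L * (\<Sum>i\<in>I. \<bar>a i - b i\<bar>)"
    using f g unfolding lipschitz_on_bounded_def by blast
  \<comment> \<open>Comparison with the origin bounds the factors; \<open>R\<close> is nonnegative so that the origin is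
    admissible.\<close>
  have bdd: "\<bar>h a\<bar> \<le> \<bar>h (\<lambda>_. 0)\<bar> + \<bar>C\<bar> * (\<Sum>i\<in>I. R)"
    if h: "\<And>a b. \<forall>i\<in>I. \<bar>a i\<bar> \<le> R \<Longrightarrow> \<forall>i\<in>I. \<bar>b i\<bar> \<le> R \<Longrightarrow> \<bar>h a - h b\<bar> \<le> C * (\<Sum>i\<in>I. \<bar>a i - b i\<bar>)"
      and a: "\<forall>i\<in>I. \<bar>a i\<bar> \<le> R" for h :: "('a \<Rightarrow> real) \<Rightarrow> real" and C a
  proof -
    have "\<bar>h a - h (\<lambda>_. 0)\<bar> \<le> C * (\<Sum>i\<in>I. \<bar>a i - 0\<bar>)"
      using a by (intro h) (auto simp: R_def)
    also have "\<dots> \<le> \<bar>C\<bar> * (\<Sum>i\<in>I. R)"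
      using a by (intro mult_mono sum_mono) (auto intro: sum_nonneg)
    finally show ?thesis by linarith
  qed
  define A where "A = \<bar>f (\<lambda>_. 0)\<bar> + \<bar>K\<bar> * (\<Sum>i\<in>I. R)"
  define B where "B = \<bar>g (\<lambda>_. 0)\<bar> + \<bar>L\<bar> * (\<Sum>i\<in>I. R)"
  have "\<bar>f a * g a - f b * g b\<bar> \<le> (A * L + B * K) * (\<Sum>i\<in>I. \<bar>a i - b i\<bar>)"
    if "\<forall>i\<in>I. \<bar>a i\<bar> \<le> M" "\<forall>i\<in>I. \<bar>b i\<bar> \<le> M" for a b
  proof -
    have ab: "\<forall>i\<in>I. \<bar>a i\<bar> \<le> R" "\<forall>i\<in>I. \<bar>b i\<bar> \<le> R" using that by (auto simp: R_def le_max_iff_disj)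
    have fA: "\<bar>f a\<bar> \<le> A" unfolding A_def by (rule bdd[OF K ab(1)])
    have gB: "\<bar>g b\<bar> \<le> B" unfolding B_def by (rule bdd[OF L ab(2)])
    have "f a * g a - f b * g b = f a * (g a - g b) + g b * (f a - f b)" by (simp add: algebra_simps)
    hence "\<bar>f a * g a - f b * g b\<bar> \<le> \<bar>f a\<bar> * \<bar>g a - g b\<bar> + \<bar>g b\<bar> * \<bar>f a - f b\<bar>"
      by (metis abs_mult abs_triangle_ineq)
    also have "\<dots> \<le> A * (L * (\<Sum>i\<in>I. \<bar>a i - b i\<bar>)) + B * (K * (\<Sum>i\<in>I. \<bar>a i - b i\<bar>))"
      using fA gB K[OF ab] L[OF ab] by (intro add_mono mult_mono) auto
    finally show ?thesis by (simp add: algebra_simps)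
  qed
  thus "\<exists>L. \<forall>a b. (\<forall>i\<in>I. \<bar>a i\<bar> \<le> M) \<longrightarrow> (\<forall>i\<in>I. \<bar>b i\<bar> \<le> M) \<longrightarrow>
      \<bar>f a * g a - f b * g b\<bar> \<le> L * (\<Sum>i\<in>I. \<bar>a i - b i\<bar>)" by blast
qed

lemma lipschitz_on_bounded_sum:
  assumes "\<And>j. j \<in> J \<Longrightarrow> lipschitz_on_bounded I (f j)"
  shows "lipschitz_on_bounded I (\<lambda>c. \<Sum>j\<in>J. f j c)"
  using assms
  by (induction J rule: infinite_finite_induct)
    (auto intro: lipschitz_on_bounded_const lipschitz_on_bounded_add)

section \<open>The Galerkin vector field\<close>

text \<open>The time derivative of a solution \<open>u\<close> tested with \<open>v\<close>.\<close>

definition galerkin_form :: "real \<Rightarrow> real \<Rightarrow> real \<Rightarrow> fn2 \<Rightarrow> fn2 \<Rightarrow> real" where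
  "galerkin_form \<gamma> \<gamma>1 \<gamma>2 u v = - \<gamma> * L2_inner (laplacian u) (laplacian v)
     + L2_inner (\<lambda>z. phi \<gamma>1 \<gamma>2 (u z)) (laplacian v) + L2_inner (div_scalar (\<lambda>z. psi (u z))) v"

text \<open>The equation tested with \<open>sine k\<close>; the divisor \<open>pi\<^sup>2\<close> is the squared norm of \<open>sine k\<close>.\<close>

definition galerkin_field :: "real \<Rightarrow> real \<Rightarrow> real \<Rightarrow> nat \<Rightarrow> nat \<times> nat \<Rightarrow> (nat \<times> nat \<Rightarrow> real) \<Rightarrow> real" where
  "galerkin_field \<gamma> \<gamma>1 \<gamma>2 N k c = galerkin_form \<gamma> \<gamma>1 \<gamma>2 (sine_sum N c) (sine k) / pi\<^sup>2"

lemma smooth_laplacian: "smooth f \<Longrightarrow> smooth (laplacian f)"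
  unfolding laplacian_def[abs_def] by (intro smooth_intros)

lemma smooth_div_scalar: "smooth f \<Longrightarrow> smooth (div_scalar f)"
  unfolding div_scalar_def[abs_def] by (intro smooth_intros)

lemma smooth_phi: "smooth f \<Longrightarrow> smooth (\<lambda>z. phi \<gamma>1 \<gamma>2 (f z))"
  unfolding phi_def[abs_def] by (intro smooth_intros)

lemma smooth_psi: "smooth f \<Longrightarrow> smooth (\<lambda>z. psi (f z))"
  unfolding psi_def[abs_def] by (intro smooth_intros)

lemma galerkin_form_sine_sum:
  assumes u: "smooth u"
  shows "galerkin_form \<gamma> \<gamma>1 \<gamma>2 u (sine_sum N d) = (\<Sum>k\<in>modes N. d k * galerkin_form \<gamma> \<gamma>1 \<gamma>2 u (sine k))"
proof -
  have lap: "laplacian (sine_sum N d) = (\<lambda>z. \<Sum>k\<in>modes N. d k * laplacian (sine k) z)"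
    by (auto simp: laplacian_sine_sum laplacian_sine sine_sum_def fun_eq_iff intro!: sum.cong)
  note L = smooth_in_L2[OF smooth_laplacian[OF u]] smooth_in_L2[OF smooth_phi[OF u]]
    smooth_in_L2[OF smooth_laplacian[OF smooth_sine]]
    smooth_in_L2[OF smooth_div_scalar[OF smooth_psi[OF u]]]
  show ?thesis
    unfolding galerkin_form_def lap unfolding sine_sum_eq
    by (simp add: L2_inner_sum_right L sum_distrib_left sum.distrib sum_subtractf sum_negf algebra_simps)
qed

text \<open>Expanding one factor \<open>sine_sum N c\<close> gives a linear combination, with coefficients \<open>c k\<close>, of expressions
  of the same kind with one power less and weight \<open>h * sine k\<close>; hence the general weight \<open>h\<close>.\<close>

lemma lipschitz_on_bounded_integral_power:
  assumes "smooth h" "smooth g"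
  shows "lipschitz_on_bounded (modes N) (\<lambda>c. L2_inner (\<lambda>z. h z * sine_sum N c z ^ n) g)"
  using assms(1)
proof (induction n arbitrary: h)
  case 0
  thus ?case by (simp add: lipschitz_on_bounded_const)
next
  case (Suc n)
  have "L2_inner (\<lambda>z. h z * sine_sum N c z ^ Suc n) g
      = (\<Sum>k\<in>modes N. c k * L2_inner (\<lambda>z. (h z * sine k z) * sine_sum N c z ^ n) g)" for c
  proof -
    have "(\<lambda>z. h z * sine_sum N c z ^ Suc n)
        = (\<lambda>z. \<Sum>k\<in>modes N. c k * ((h z * sine k z) * sine_sum N c z ^ n))"
      by (simp add: fun_eq_iff sine_sum_def[of N c] sum_distrib_left sum_distrib_right mult_ac)
    thus ?thesis
      using Suc.prems assms(2)
      by (simp only:) (intro L2_inner_sum_left smooth_in_L2 smooth_intros smooth_sine smooth_sine_sum)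
  qed
  thus ?case
    using Suc.prems
    by (simp only:) (intro lipschitz_on_bounded_sum lipschitz_on_bounded_mult Suc.IH
        lipschitz_on_bounded_coordinate finite_modes smooth_intros smooth_sine)
qed

lemma L2_inner_phi:
  assumes u: "smooth u" and g: "smooth g"
  shows "L2_inner (\<lambda>z. phi \<gamma>1 \<gamma>2 (u z)) g
    = \<gamma>2 * L2_inner (\<lambda>z. u z ^ 3) g + \<gamma>1 * L2_inner (\<lambda>z. u z ^ 2) g - L2_inner u g"
proof -
  have i: "integrable (lebesgue_on Omega) (\<lambda>z. u z ^ n * g z)" for n
    by (intro integrable_Omega smooth_continuous_on smooth_intros u g)
  have "L2_inner (\<lambda>z. phi \<gamma>1 \<gamma>2 (u z)) g = integral\<^sup>L (lebesgue_on Omega)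
     (\<lambda>z. \<gamma>2 * (u z ^ 3 * g z) + \<gamma>1 * (u z ^ 2 * g z) - u z ^ 1 * g z)"
    by (simp add: L2_inner_def phi_def algebra_simps)
  also have "\<dots> = \<gamma>2 * L2_inner (\<lambda>z. u z ^ 3) g + \<gamma>1 * L2_inner (\<lambda>z. u z ^ 2) g - L2_inner (\<lambda>z. u z ^ 1) g"
    unfolding L2_inner_def
    by (simp only: Bochner_Integration.integral_add Bochner_Integration.integral_diff
        Bochner_Integration.integral_mult_right Bochner_Integration.integrable_add
        Bochner_Integration.integrable_mult_right i)
  finally show ?thesis by simp
qed

lemma L2_inner_div_scalar:
  assumes u: "smooth u" and g: "smooth g"
    and "\<And>y. u (2*pi, y) * g (2*pi, y) = u (0, y) * g (0, y)"
        "\<And>x. u (x, 2*pi) * g (x, 2*pi) = u (x, 0) * g (x, 0)"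
  shows "L2_inner (div_scalar u) g = - L2_inner u (div_scalar g)"
proof -
  note L = smooth_in_L2[OF smooth_partial(1)[OF u]] smooth_in_L2[OF smooth_partial(2)[OF u]]
    smooth_in_L2[OF smooth_partial(1)[OF g]] smooth_in_L2[OF smooth_partial(2)[OF g]]
    smooth_in_L2[OF u] smooth_in_L2[OF g]
  have "L2_inner g (div_scalar u) = L2_inner g (partial_x u) + L2_inner g (partial_y u)"
    unfolding div_scalar_def[abs_def] by (intro L2_inner_add_right L)
  moreover have "L2_inner u (div_scalar g) = L2_inner u (partial_x g) + L2_inner u (partial_y g)"
    unfolding div_scalar_def[abs_def] by (intro L2_inner_add_right L)
  moreover have "L2_inner u (partial_x g) = - L2_inner (partial_x u) g"
    using assms by (intro integration_by_parts)
  moreover have "L2_inner u (partial_y g) = - L2_inner (partial_y u) g"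
    using assms by (intro integration_by_parts)
  ultimately show ?thesis by (simp add: L2_inner_commute[of g])
qed

lemma sine_boundary: "sine k (0, y) = 0" "sine k (2*pi, y) = 0" "sine k (x, 0) = 0" "sine k (x, 2*pi) = 0"
  using sin_period_2pi[of _ 0] by (simp_all add: sine_def)

text \<open>The derivatives in the convection term are moved to the test function, after which every term is a
  multiple of an integral of a power of \<open>sine_sum N c\<close> against a fixed smooth function.\<close>

lemma lipschitz_galerkin_field: "lipschitz_on_bounded (modes N) (galerkin_field \<gamma> \<gamma>1 \<gamma>2 N k)"
proof -
  let ?u = "sine_sum N"
  note lob = lipschitz_on_bounded_integral_power[OF smooth_const[of 1], simplified]
  note lob1 = lob[where n = 1, simplified]
  have lap: "L2_inner (laplacian (?u c)) (laplacian (sine k)) =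
      (\<Sum>i\<in>modes N. c i * L2_inner (laplacian (sine i)) (laplacian (sine k)))" for c
  proof -
    have "laplacian (?u c) = (\<lambda>z. \<Sum>i\<in>modes N. c i * laplacian (sine i) z)"
      by (auto simp: laplacian_sine_sum laplacian_sine sine_sum_def fun_eq_iff intro!: sum.cong)
    thus ?thesis
      by (simp add: L2_inner_sum_left smooth_in_L2 smooth_laplacian smooth_sine)
  qed
  have conv: "L2_inner (div_scalar (\<lambda>z. psi (?u c z))) (sine k)
      = - L2_inner (\<lambda>z. ?u c z ^ 2) (div_scalar (sine k))" for c
    using L2_inner_div_scalar[OF smooth_psi[OF smooth_sine_sum] smooth_sine]
    by (simp add: sine_boundary psi_def)
  have eq: "galerkin_field \<gamma> \<gamma>1 \<gamma>2 N k = (\<lambda>c. inverse (pi\<^sup>2) *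
     ((- \<gamma>) * (\<Sum>i\<in>modes N. c i * L2_inner (laplacian (sine i)) (laplacian (sine k)))
      + (\<gamma>2 * L2_inner (\<lambda>z. ?u c z ^ 3) (laplacian (sine k))
      + (\<gamma>1 * L2_inner (\<lambda>z. ?u c z ^ 2) (laplacian (sine k))
      + ((-1) * L2_inner (?u c) (laplacian (sine k))
      + (-1) * L2_inner (\<lambda>z. ?u c z ^ 2) (div_scalar (sine k)))))))"
    by (simp add: fun_eq_iff galerkin_field_def galerkin_form_def lap conv
        L2_inner_phi smooth_sine_sum smooth_laplacian smooth_sine divide_inverse)
  show ?thesis
    unfolding eq
    by (intro lipschitz_on_bounded_mult lipschitz_on_bounded_add lipschitz_on_bounded_sum
        lipschitz_on_bounded_const lipschitz_on_bounded_coordinate finite_modes lob lob1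
        smooth_laplacian smooth_div_scalar smooth_sine)
qed

section \<open>The energy inequality\<close>

lemma L2_inner_laplacian:
  assumes u: "smooth u" and f: "smooth f"
    and "\<And>y. f (2*pi, y) = 0" "\<And>y. f (0, y) = 0" "\<And>x. f (x, 2*pi) = 0" "\<And>x. f (x, 0) = 0"
  shows "L2_inner f (laplacian u)
    = - (L2_inner (partial_x f) (partial_x u) + L2_inner (partial_y f) (partial_y u))"
proof -
  have "L2_inner f (laplacian u) = L2_inner f (partial_x (partial_x u)) + L2_inner f (partial_y (partial_y u))"
    unfolding laplacian_def[abs_def] by (intro L2_inner_add_right smooth_in_L2 smooth_partial u f)
  moreover have "L2_inner f (partial_x (partial_x u)) = - L2_inner (partial_x f) (partial_x u)"
    using assms by (intro integration_by_parts smooth_partial) auto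
  moreover have "L2_inner f (partial_y (partial_y u)) = - L2_inner (partial_y f) (partial_y u)"
    using assms by (intro integration_by_parts smooth_partial) auto
  ultimately show ?thesis by simp
qed

lemma partial_phi:
  assumes "smooth u"
  shows "partial_x (\<lambda>z. phi \<gamma>1 \<gamma>2 (u z)) = (\<lambda>z. (3 * \<gamma>2 * (u z)\<^sup>2 + 2 * \<gamma>1 * u z - 1) * partial_x u z)"
    and "partial_y (\<lambda>z. phi \<gamma>1 \<gamma>2 (u z)) = (\<lambda>z. (3 * \<gamma>2 * (u z)\<^sup>2 + 2 * \<gamma>1 * u z - 1) * partial_y u z)"
proof -
  have d: "(phi \<gamma>1 \<gamma>2 has_real_derivative (3 * \<gamma>2 * s\<^sup>2 + 2 * \<gamma>1 * s - 1)) (at s)" for s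
    unfolding phi_def[abs_def] by (auto intro!: derivative_eq_intros)
  note u = smooth_differentiable[OF assms]
  show "partial_x (\<lambda>z. phi \<gamma>1 \<gamma>2 (u z)) = (\<lambda>z. (3 * \<gamma>2 * (u z)\<^sup>2 + 2 * \<gamma>1 * u z - 1) * partial_x u z)"
    by (intro partial_x_eqI DERIV_chain2[OF d] has_real_derivative_partial_x u)
  show "partial_y (\<lambda>z. phi \<gamma>1 \<gamma>2 (u z)) = (\<lambda>z. (3 * \<gamma>2 * (u z)\<^sup>2 + 2 * \<gamma>1 * u z - 1) * partial_y u z)"
    by (intro partial_y_eqI DERIV_chain2[OF d] has_real_derivative_partial_y u)
qed

text \<open>Completing the square.\<close>

lemma phi_deriv_lower_bound:
  fixes s :: real
  assumes "\<gamma>2 > 0"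
  shows "- (3 * \<gamma>2 * s\<^sup>2 + 2 * \<gamma>1 * s - 1) \<le> 1 + \<gamma>1\<^sup>2 / (3 * \<gamma>2)"
proof -
  have "3 * \<gamma>2 * (s + \<gamma>1 / (3 * \<gamma>2))\<^sup>2 = 3 * \<gamma>2 * s\<^sup>2 + 2 * \<gamma>1 * s + \<gamma>1\<^sup>2 / (3 * \<gamma>2)"
    using assms by (simp add: field_simps power2_eq_square)
  moreover have "3 * \<gamma>2 * (s + \<gamma>1 / (3 * \<gamma>2))\<^sup>2 \<ge> 0" using assms by simp
  ultimately show ?thesis by linarith
qed

lemma L2_inner_weight_le:
  assumes a: "smooth a" and f: "smooth f" and le: "\<And>z. a z \<le> C"
  shows "L2_inner (\<lambda>z. a z * f z) f \<le> C * L2_inner f f"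
proof -
  have "L2_inner (\<lambda>z. a z * f z) f \<le> integral\<^sup>L (lebesgue_on Omega) (\<lambda>z. C * (f z * f z))"
    unfolding L2_inner_def
  proof (rule integral_mono)
    show "integrable (lebesgue_on Omega) (\<lambda>z. a z * f z * f z)"
      "integrable (lebesgue_on Omega) (\<lambda>z. C * (f z * f z))"
      by (intro integrable_Omega smooth_continuous_on smooth_intros a f)+
    show "a z * f z * f z \<le> C * (f z * f z)" for z
      using mult_right_mono[OF le[of z], of "f z * f z"] by (simp add: mult.assoc)
  qed
  thus ?thesis by (simp add: L2_inner_def)
qed

text \<open>Call the left-hand side \<open>X\<close>. By the product rule \<open>X = 2 * Y\<close>, where \<open>Y\<close> is the inner product of
  \<open>u\<^sup>2\<close> with \<open>div_scalar u\<close>; integration by parts gives \<open>X = - Y\<close>.\<close>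

lemma convection_energy_eq_0:
  assumes u: "smooth u"
    and bd: "\<And>y. u (2*pi, y) = 0" "\<And>y. u (0, y) = 0" "\<And>x. u (x, 2*pi) = 0" "\<And>x. u (x, 0) = 0"
  shows "L2_inner (div_scalar (\<lambda>z. psi (u z))) u = 0"
proof -
  have "div_scalar (\<lambda>z. psi (u z)) = (\<lambda>z. 2 * (u z * div_scalar u z))"
    unfolding div_scalar_def psi_def power2_eq_square
    using u by (simp add: partial_mult smooth_differentiable fun_eq_iff algebra_simps)
  hence "L2_inner (div_scalar (\<lambda>z. psi (u z))) u
      = integral\<^sup>L (lebesgue_on Omega) (\<lambda>z. 2 * (psi (u z) * div_scalar u z))"
    unfolding L2_inner_def by (simp only:) (simp add: psi_def power2_eq_square mult_ac)
  hence "L2_inner (div_scalar (\<lambda>z. psi (u z))) u = 2 * L2_inner (\<lambda>z. psi (u z)) (div_scalar u)"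
    by (simp add: L2_inner_def)
  moreover have "L2_inner (div_scalar (\<lambda>z. psi (u z))) u = - L2_inner (\<lambda>z. psi (u z)) (div_scalar u)"
    by (intro L2_inner_div_scalar smooth_psi u) (simp_all add: bd)
  ultimately show ?thesis by simp
qed

text \<open>Integration by parts makes the diffusion term the integral of \<open>- \<phi>'(u)\<close> against the squared
  gradient. Integrating by parts once more, the Dirichlet integral is \<open>- (u, \<Delta>u)\<close>, which is diagonal
  in the basis.\<close>

lemma galerkin_form_energy:
  fixes \<gamma>1 :: real
  assumes "\<gamma> > 0" "\<gamma>2 > 0"
  defines "C \<equiv> 1 + \<gamma>1\<^sup>2 / (3 * \<gamma>2)"
  shows "galerkin_form \<gamma> \<gamma>1 \<gamma>2 (sine_sum N c) (sine_sum N c)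
    \<le> C * pi\<^sup>2 * (\<Sum>k\<in>modes N. eigenvalue k * (c k)\<^sup>2)"
proof -
  let ?u = "sine_sum N c"
  let ?w = "\<lambda>z. 3 * \<gamma>2 * (?u z)\<^sup>2 + 2 * \<gamma>1 * ?u z - 1"
  have u: "smooth ?u" by (rule smooth_sine_sum)
  have "smooth ?w" by (intro smooth_intros u)
  from smooth_diff[OF smooth_const[of 0] this] have w: "smooth (\<lambda>z. - ?w z)"
    by (simp only: diff_0)
  have wC: "- ?w z \<le> C" for z unfolding C_def by (rule phi_deriv_lower_bound[OF assms(2)])
  have weight: "- L2_inner (\<lambda>z. ?w z * f z) f \<le> C * L2_inner f f" if "smooth f" for f
    using L2_inner_weight_le[OF w that wC] unfolding L2_inner_def
    by (simp only: mult_minus_left Bochner_Integration.integral_minus)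
  have "L2_inner (\<lambda>z. phi \<gamma>1 \<gamma>2 (?u z)) (laplacian ?u)
      = - (L2_inner (\<lambda>z. ?w z * partial_x ?u z) (partial_x ?u) + L2_inner (\<lambda>z. ?w z * partial_y ?u z) (partial_y ?u))"
    by (subst L2_inner_laplacian[OF u smooth_phi[OF u]])
      (simp_all add: sine_sum_boundary phi_def[of _ _ 0] partial_phi[OF u])
  also have "\<dots> \<le> C * (L2_inner (partial_x ?u) (partial_x ?u) + L2_inner (partial_y ?u) (partial_y ?u))"
    using weight[OF smooth_partial(1)[OF u]] weight[OF smooth_partial(2)[OF u]]
    by (simp add: algebra_simps)
  also have "L2_inner (partial_x ?u) (partial_x ?u) + L2_inner (partial_y ?u) (partial_y ?u)
      = - L2_inner ?u (laplacian ?u)"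
    by (subst L2_inner_laplacian[OF u u]) (simp_all add: sine_sum_boundary)
  also have "\<dots> = pi\<^sup>2 * (\<Sum>k\<in>modes N. eigenvalue k * (c k)\<^sup>2)"
    by (simp add: laplacian_sine_sum L2_inner_sine_sum sum_negf power2_eq_square mult_ac)
  finally have "L2_inner (\<lambda>z. phi \<gamma>1 \<gamma>2 (?u z)) (laplacian ?u)
      \<le> C * pi\<^sup>2 * (\<Sum>k\<in>modes N. eigenvalue k * (c k)\<^sup>2)" by (simp add: mult.assoc)
  moreover have "L2_inner (div_scalar (\<lambda>z. psi (?u z))) ?u = 0"
    by (intro convection_energy_eq_0 u sine_sum_boundary)
  moreover have "\<gamma> * L2_inner (laplacian ?u) (laplacian ?u) \<ge> 0"
    using assms(1) by (simp add: L2_inner_def)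
  ultimately show ?thesis by (simp add: galerkin_form_def)
qed

text \<open>The eigenvalues of the modes in \<open>S_space N\<close> are at most \<open>8 N\<^sup>2\<close>, so the gradient is controlled by
  the function itself.\<close>

lemma galerkin_field_energy:
  assumes "\<gamma> > 0" "\<gamma>2 > 0"
  shows "(\<Sum>k\<in>modes N. galerkin_field \<gamma> \<gamma>1 \<gamma>2 N k c * c k)
    \<le> (1 + \<gamma>1\<^sup>2 / (3 * \<gamma>2)) * (8 * (real N)\<^sup>2) * (\<Sum>k\<in>modes N. (c k)\<^sup>2)"
proof -
  define C where "C = 1 + \<gamma>1\<^sup>2 / (3 * \<gamma>2)"
  have C: "C \<ge> 0" using assms by (simp add: C_def)
  have ev: "eigenvalue k \<le> 8 * (real N)\<^sup>2" if "k \<in> modes N" for k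
  proof -
    have "real (fst k) \<le> 2 * real N" "real (snd k) \<le> 2 * real N"
      using that by (auto simp: modes_def)
    hence "(real (fst k))\<^sup>2 \<le> (2 * real N)\<^sup>2" "(real (snd k))\<^sup>2 \<le> (2 * real N)\<^sup>2"
      by (intro power_mono; simp)+
    thus ?thesis by (simp add: eigenvalue_def power_mult_distrib)
  qed
  have "(\<Sum>k\<in>modes N. galerkin_field \<gamma> \<gamma>1 \<gamma>2 N k c * c k)
      = galerkin_form \<gamma> \<gamma>1 \<gamma>2 (sine_sum N c) (sine_sum N c) / pi\<^sup>2"
    by (simp add: galerkin_form_sine_sum smooth_sine_sum galerkin_field_def sum_divide_distrib mult_ac)
  also have "\<dots> \<le> C * (\<Sum>k\<in>modes N. eigenvalue k * (c k)\<^sup>2)"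
    using galerkin_form_energy[OF assms, of \<gamma>1 N c] by (simp add: C_def divide_le_eq mult_ac)
  also have "\<dots> \<le> C * (\<Sum>k\<in>modes N. (8 * (real N)\<^sup>2) * (c k)\<^sup>2)"
    using C ev by (intro mult_left_mono sum_mono mult_right_mono) auto
  also have "\<dots> = C * (8 * (real N)\<^sup>2) * (\<Sum>k\<in>modes N. (c k)\<^sup>2)"
    by (simp add: sum_distrib_left mult_ac)
  finally show ?thesis by (simp add: C_def)
qed

section \<open>Regularity of curves in the Galerkin space\<close>

lemma partial_funpow_sum:
  assumes "\<And>k. k \<in> I \<Longrightarrow> smooth (f k)"
  shows "(partial_x ^^ i) (\<lambda>z. \<Sum>k\<in>I. a k * f k z) = (\<lambda>z. \<Sum>k\<in>I. a k * (partial_x ^^ i) (f k) z)"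
    and "(partial_y ^^ i) (\<lambda>z. \<Sum>k\<in>I. a k * f k z) = (\<lambda>z. \<Sum>k\<in>I. a k * (partial_y ^^ i) (f k) z)"
proof -
  have sm: "smooth (\<lambda>z. a k * g z)" if "smooth g" for g k using that by (intro smooth_intros)
  show "(partial_x ^^ i) (\<lambda>z. \<Sum>k\<in>I. a k * f k z) = (\<lambda>z. \<Sum>k\<in>I. a k * (partial_x ^^ i) (f k) z)"
    using assms by (induction i) (simp_all add: partial_sum partial_cmult sm smooth_partial_funpow)
  show "(partial_y ^^ i) (\<lambda>z. \<Sum>k\<in>I. a k * f k z) = (\<lambda>z. \<Sum>k\<in>I. a k * (partial_y ^^ i) (f k) z)"
    using assms by (induction i) (simp_all add: partial_sum partial_cmult sm smooth_partial_funpow)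
qed

text \<open>The matrix \<open>R\<close> collects the inner products of the derivatives of the basis functions. The
  formula makes the continuous dependence of the norm on the coefficients evident.\<close>

lemma H_norm_sine_sum:
  "\<exists>R. \<forall>c. H_norm n (sine_sum N c) = sqrt (\<Sum>k\<in>modes N. \<Sum>l\<in>modes N. c k * c l * R k l)"
proof -
  define D where "D = (\<lambda>(p :: nat \<times> nat) f. (partial_y ^^ snd p) ((partial_x ^^ fst p) f))"
  define P where "P = {p :: nat \<times> nat. fst p + snd p \<le> n}"
  define R where "R = (\<lambda>k l. \<Sum>p\<in>P. L2_inner (D p (sine k)) (D p (sine l)))"
  have L: "D p (sine k) \<in> L2" for p k
    unfolding D_def by (intro smooth_in_L2 smooth_partial_funpow smooth_sine)
  have Dsum: "D p (sine_sum N c) = (\<lambda>z. \<Sum>k\<in>modes N. c k * D p (sine k) z)" for p c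
    unfolding D_def sine_sum_eq
    by (simp add: partial_funpow_sum smooth_sine smooth_partial_funpow)
  have L': "(\<lambda>z. \<Sum>k\<in>modes N. c k * D p (sine k) z) \<in> L2" for p c
    unfolding D_def by (intro smooth_in_L2 smooth_sum smooth_mult smooth_const smooth_partial_funpow smooth_sine)
  have "H_norm n (sine_sum N c) = sqrt (\<Sum>k\<in>modes N. \<Sum>l\<in>modes N. c k * c l * R k l)" for c
  proof -
    have "H_norm n (sine_sum N c) = sqrt (\<Sum>p\<in>P. L2_inner (D p (sine_sum N c)) (D p (sine_sum N c)))"
      by (simp add: H_norm_smooth smooth_sine_sum D_def P_def case_prod_unfold)
    also have "(\<Sum>p\<in>P. L2_inner (D p (sine_sum N c)) (D p (sine_sum N c)))
        = (\<Sum>p\<in>P. \<Sum>k\<in>modes N. \<Sum>l\<in>modes N. c k * c l * L2_inner (D p (sine k)) (D p (sine l)))"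
      unfolding Dsum
      by (simp add: L2_inner_sum_left L2_inner_sum_right L L' sum_distrib_left mult_ac)
    also have "\<dots> = (\<Sum>k\<in>modes N. \<Sum>p\<in>P. \<Sum>l\<in>modes N. c k * c l * L2_inner (D p (sine k)) (D p (sine l)))"
      by (rule sum.swap)
    also have "\<dots> = (\<Sum>k\<in>modes N. \<Sum>l\<in>modes N. c k * c l * R k l)"
      unfolding R_def sum_distrib_left by (intro sum.cong refl sum.swap)
    finally show ?thesis .
  qed
  thus ?thesis by blast
qed

lemma simple_function_floor:
  fixes a T :: real
  shows "simple_function (lebesgue_on {0<..<T}) (\<lambda>t. \<lfloor>a * t\<rfloor>)"
  unfolding simple_function_def
proof (intro conjI ballI)
  have "(\<lambda>t. \<lfloor>a * t\<rfloor>) ` {0<..<T} \<subseteq> {- \<lceil>\<bar>a\<bar> * \<bar>T\<bar>\<rceil> .. \<lceil>\<bar>a\<bar> * \<bar>T\<bar>\<rceil>}"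
  proof
    fix m assume "m \<in> (\<lambda>t. \<lfloor>a * t\<rfloor>) ` {0<..<T}"
    then obtain t where t: "t \<in> {0<..<T}" "m = \<lfloor>a * t\<rfloor>" by blast
    have "\<bar>a * t\<bar> \<le> \<bar>a\<bar> * \<bar>T\<bar>" using t(1) by (simp add: abs_mult mult_left_mono)
    hence "- real_of_int \<lceil>\<bar>a\<bar> * \<bar>T\<bar>\<rceil> \<le> a * t" "a * t \<le> real_of_int \<lceil>\<bar>a\<bar> * \<bar>T\<bar>\<rceil>"
      by linarith+
    thus "m \<in> {- \<lceil>\<bar>a\<bar> * \<bar>T\<bar>\<rceil> .. \<lceil>\<bar>a\<bar> * \<bar>T\<bar>\<rceil>}"
      unfolding t(2) by (auto simp: le_floor_iff floor_le_iff)
  qed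
  thus "finite ((\<lambda>t. \<lfloor>a * t\<rfloor>) ` space (lebesgue_on {0<..<T}))"
    by (auto intro: finite_subset)
  have "(\<lambda>t. \<lfloor>a * t\<rfloor>) \<in> measurable borel (count_space UNIV)" by measurable
  hence "(\<lambda>t. \<lfloor>a * t\<rfloor>) \<in> measurable lborel (count_space UNIV)" by simp
  hence "(\<lambda>t. \<lfloor>a * t\<rfloor>) \<in> measurable (lebesgue_on {0<..<T}) (count_space UNIV)"
    by (intro measurable_restrict_space1 measurable_completion)
  thus "(\<lambda>t. \<lfloor>a * t\<rfloor>) -` {x} \<inter> space (lebesgue_on {0<..<T}) \<in> sets (lebesgue_on {0<..<T})" for x
    by (rule measurable_sets) simp
qed

text \<open>The \<open>H_norm n\<close> of the curve is continuous on the compact interval, hence bounded and square integrable.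
  Sampling the curve at the grid points \<open>\<lfloor>m t\<rfloor> / m\<close> gives simple functions that converge to it.\<close>

lemma sine_sum_Bochner:
  assumes T: "T > 0" and c: "\<And>k. k \<in> modes N \<Longrightarrow> continuous_on {0..T} (\<lambda>t. c t k)"
  defines "u \<equiv> \<lambda>t. sine_sum N (c t)"
  shows "u \<in> Bochner_Linf (H_per n) (H_norm n) T" and "u \<in> Bochner_L2 (H_per n) (H_norm n) T"
proof -
  obtain R where R: "\<And>a. H_norm n (sine_sum N a) = sqrt (\<Sum>k\<in>modes N. \<Sum>l\<in>modes N. a k * a l * R k l)"
    using H_norm_sine_sum by blast
  have per: "sine_sum N a \<in> H_per n" for a
    by (rule smooth_periodic_in_H_per[OF sine_sum_smooth_periodic])
  have cont: "continuous_on {0..T} (\<lambda>t. H_norm n (u t))"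
    unfolding u_def R by (intro continuous_intros c)
  \<comment> \<open>Rounding down, so that the sampling times stay in the interval where \<open>c\<close> is continuous; the grid
    width is \<open>1 / Suc m\<close> to avoid division by 0.\<close>
  define \<tau> where "\<tau> = (\<lambda>m t. real_of_int \<lfloor>real (Suc m) * t\<rfloor> / real (Suc m))"
  define s where "s = (\<lambda>m t. u (\<tau> m t))"
  have \<tau>_le: "\<tau> m t \<le> t" and \<tau>_ge: "t - inverse (real (Suc m)) \<le> \<tau> m t" for m t
  proof -
    have "real_of_int \<lfloor>real (Suc m) * t\<rfloor> \<le> real (Suc m) * t"
         "real (Suc m) * t - 1 \<le> real_of_int \<lfloor>real (Suc m) * t\<rfloor>" by linarith+
    hence "\<tau> m t \<le> real (Suc m) * t / real (Suc m)" "(real (Suc m) * t - 1) / real (Suc m) \<le> \<tau> m t"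
      unfolding \<tau>_def by (intro divide_right_mono; simp)+
    moreover have "real (Suc m) * t / real (Suc m) = t"
        "(real (Suc m) * t - 1) / real (Suc m) = t - inverse (real (Suc m))"
      by (simp_all add: diff_divide_distrib inverse_eq_divide del: of_nat_Suc)
    ultimately show "\<tau> m t \<le> t" "t - inverse (real (Suc m)) \<le> \<tau> m t" by simp_all
  qed
  have \<tau>_lim: "(\<lambda>m. \<tau> m t) \<longlonglongrightarrow> t" for t
  proof (rule tendsto_sandwich[OF _ _ _ tendsto_const])
    show "(\<lambda>m. t - inverse (real (Suc m))) \<longlonglongrightarrow> t"
      using tendsto_diff[OF tendsto_const LIMSEQ_inverse_real_of_nat, of t] by simp
  qed (intro always_eventually allI \<tau>_le \<tau>_ge)+
  have \<tau>_T: "\<tau> m t \<in> {0..T}" if "t \<in> {0<..<T}" for m t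
    using that \<tau>_le[of m t] by (auto simp: \<tau>_def)
  have lim: "(\<lambda>m. H_norm n (\<lambda>z. s m t z - u t z)) \<longlonglongrightarrow> 0" if t: "t \<in> {0<..<T}" for t
  proof -
    have "(\<lambda>m. c (\<tau> m t) k) \<longlonglongrightarrow> c t k" if "k \<in> modes N" for k
      using t \<tau>_T[OF t] by (intro continuous_on_tendsto_compose[OF c[OF that] \<tau>_lim]) auto
    hence "(\<lambda>m. sqrt (\<Sum>k\<in>modes N. \<Sum>l\<in>modes N.
              (c (\<tau> m t) k - c t k) * (c (\<tau> m t) l - c t l) * R k l))
          \<longlonglongrightarrow> sqrt (\<Sum>k\<in>modes N. \<Sum>l\<in>modes N. (c t k - c t k) * (c t l - c t l) * R k l)"
      by (intro tendsto_intros)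
    moreover have "(\<lambda>z. s m t z - u t z) = sine_sum N (\<lambda>k. c (\<tau> m t) k - c t k)" for m
      by (simp add: fun_eq_iff s_def u_def sine_sum_diff)
    ultimately show ?thesis by (simp add: R)
  qed
  have sm: "strongly_measurable (H_per n) (H_norm n) T u"
    unfolding strongly_measurable_def
  proof (intro conjI exI[of _ s] allI ballI)
    show "AE t in lebesgue_on {0<..<T}. u t \<in> H_per n" by (simp add: u_def per)
    show "simple_function (lebesgue_on {0<..<T}) (s m)" for m
      unfolding s_def \<tau>_def by (rule simple_function_compose1[OF simple_function_floor])
    show "s m t \<in> H_per n" for m t by (simp add: s_def u_def per)
    show "AE t in lebesgue_on {0<..<T}. (\<lambda>m. H_norm n (\<lambda>z. s m t z - u t z)) \<longlonglongrightarrow> 0"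
      by (rule AE_I2) (simp add: lim)
  qed
  have "bounded ((\<lambda>t. H_norm n (u t)) ` {0..T})"
    by (intro compact_imp_bounded compact_continuous_image cont) simp
  then obtain C where "\<forall>r\<in>(\<lambda>t. H_norm n (u t)) ` {0..T}. norm r \<le> C"
    unfolding bounded_iff by blast
  hence C: "\<bar>H_norm n (u t)\<bar> \<le> C" if "t \<in> {0..T}" for t
    using that by simp
  have "AE t in lebesgue_on {0<..<T}. H_norm n (u t) \<le> C"
    by (intro AE_I2 order_trans[OF abs_ge_self C]) simp
  thus "u \<in> Bochner_Linf (H_per n) (H_norm n) T"
    using sm by (auto simp: Bochner_Linf_def)
  have "integrable (lebesgue_on {0..T}) (\<lambda>t. (H_norm n (u t))\<^sup>2)"
    by (intro continuous_imp_integrable_real continuous_intros cont)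
  hence "set_integrable lebesgue {0..T} (\<lambda>t. (H_norm n (u t))\<^sup>2)"
    by (simp add: integrable_restrict_space set_integrable_def)
  hence "set_integrable lebesgue {0<..<T} (\<lambda>t. (H_norm n (u t))\<^sup>2)"
    by (rule set_integrable_subset) auto
  hence "integrable (lebesgue_on {0<..<T}) (\<lambda>t. (H_norm n (u t))\<^sup>2)"
    by (simp add: integrable_restrict_space set_integrable_def)
  thus "u \<in> Bochner_L2 (H_per n) (H_norm n) T"
    using sm by (auto simp: Bochner_L2_def)
qed

section \<open>The semi-discrete problem\<close>

lemma sine_sum_has_derivative:
  assumes "\<And>k. k \<in> modes N \<Longrightarrow> ((\<lambda>s. c s k) has_real_derivative c' k) (at t within S)"
  shows "((\<lambda>s. sine_sum N (c s) z) has_real_derivative sine_sum N c' z) (at t within S)"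
  unfolding sine_sum_def by (intro DERIV_sum DERIV_cmult_right assms)

lemma time_deriv_eqI:
  assumes "T > 0" "t \<in> {0..T}"
    and "\<And>z. ((\<lambda>s. u s z) has_real_derivative v z) (at t within {0..T})"
  shows "time_deriv T u t = v"
  unfolding time_deriv_def using assms
  by (intro ext vector_derivative_within_closed_interval)
    (auto simp: has_real_derivative_iff_has_vector_derivative)

lemma galerkin_solution:
  assumes T: "T > 0" and u0: "u0 \<in> L2"
    and init: "\<And>k. k \<in> modes N \<Longrightarrow> x 0 k = L2_inner u0 (sine k) / pi\<^sup>2"
    and ode: "\<And>k t. k \<in> modes N \<Longrightarrow> t \<in> {0..T} \<Longrightarrow>
      ((\<lambda>s. x s k) has_real_derivative galerkin_field \<gamma> \<gamma>1 \<gamma>2 N k (x t)) (at t within {0..T})"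
  shows "semidiscrete_solution \<gamma> \<gamma>1 \<gamma>2 N T u0 (\<lambda>t. sine_sum N (x t))"
  unfolding semidiscrete_solution_def
proof (intro conjI ballI allI)
  show "sine_sum N (x t) \<in> S_space N" for t by (simp add: S_space_eq)
  have d: "((\<lambda>s. sine_sum N (x s) z) has_real_derivative
      sine_sum N (\<lambda>k. galerkin_field \<gamma> \<gamma>1 \<gamma>2 N k (x t)) z) (at t within {0..T})" if "t \<in> {0..T}" for t z
    using ode that by (intro sine_sum_has_derivative) auto
  show "(\<lambda>s. sine_sum N (x s) z) differentiable (at t within {0..T})" if "t \<in> {0..T}" for t z
    using d[OF that] real_differentiable_def by blast
  show "sine_sum N (x 0) = P_proj N u0"
    by (simp add: P_proj_eq[OF u0] fun_eq_iff sine_sum_def init)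
  fix t v assume t: "t \<in> {0..T}" and "v \<in> S_space N"
  then obtain b where v: "v = sine_sum N b" by (auto simp: S_space_eq)
  have "time_deriv T (\<lambda>t. sine_sum N (x t)) t = sine_sum N (\<lambda>k. galerkin_field \<gamma> \<gamma>1 \<gamma>2 N k (x t))"
    by (rule time_deriv_eqI[OF T t d[OF t]])
  hence "L2_inner (time_deriv T (\<lambda>t. sine_sum N (x t)) t) v = galerkin_form \<gamma> \<gamma>1 \<gamma>2 (sine_sum N (x t)) v"
    by (simp add: v L2_inner_sine_sum galerkin_form_sine_sum smooth_sine_sum galerkin_field_def
        mult_ac flip: sum_divide_distrib)
  thus "L2_inner (time_deriv T (\<lambda>t. sine_sum N (x t)) t) v
      + \<gamma> * L2_inner (laplacian (sine_sum N (x t))) (laplacian v)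
    = L2_inner (\<lambda>z. phi \<gamma>1 \<gamma>2 (sine_sum N (x t) z)) (laplacian v)
      + L2_inner (div_scalar (\<lambda>z. psi (sine_sum N (x t) z))) v"
    by (simp add: galerkin_form_def)
qed

text \<open>Differentiating \<open>w s = sine_sum N (sine_transform N (w s))\<close> pointwise in time shows that the time
  derivative lies in \<open>S_space N\<close> again, with the derivatives of the coefficients as its coefficients.
  Testing with \<open>sine k\<close> then isolates the \<open>k\<close>-th equation.\<close>

lemma galerkin_coefficients_ode:
  assumes T: "T > 0" and u0: "u0 \<in> L2"
    and w: "semidiscrete_solution \<gamma> \<gamma>1 \<gamma>2 N T u0 w"
    and k: "k \<in> modes N"
  shows "sine_transform N (w 0) k = L2_inner u0 (sine k) / pi\<^sup>2"
    and "t \<in> {0..T} \<Longrightarrow> ((\<lambda>s. sine_transform N (w s) k) has_real_derivative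
      galerkin_field \<gamma> \<gamma>1 \<gamma>2 N k (sine_transform N (w t))) (at t within {0..T})"
proof -
  show "sine_transform N (w 0) k = L2_inner u0 (sine k) / pi\<^sup>2"
    using w k by (simp add: semidiscrete_solution_def P_proj_eq[OF u0] sine_transform_sine_sum)
  assume t: "t \<in> {0..T}"
  define w' where "w' = time_deriv T w t"
  have dw: "((\<lambda>s. w s z) has_real_derivative w' z) (at t within {0..T})" for z
  proof -
    have "(\<lambda>s. w s z) differentiable (at t within {0..T})"
      using w t unfolding semidiscrete_solution_def by blast
    thus ?thesis
      by (simp add: w'_def time_deriv_def has_real_derivative_iff_has_vector_derivative
          flip: vector_derivative_works)
  qed
  have dc: "((\<lambda>s. sine_transform N (w s) l) has_real_derivative sine_transform N w' l) (at t within {0..T})" for l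
    unfolding sine_transform_def by (intro DERIV_sum DERIV_cmult dw)
  have w_eq: "sine_sum N (sine_transform N (w s)) = w s" if "s \<in> {0..T}" for s
    using w that by (intro sine_sum_sine_transform) (auto simp: semidiscrete_solution_def)
  have w'_eq: "w' = sine_sum N (sine_transform N w')"
    unfolding w'_def
  proof (rule time_deriv_eqI[OF T t])
    fix z
    have "((\<lambda>s. sine_sum N (sine_transform N (w s)) z) has_real_derivative
        sine_sum N (sine_transform N w') z) (at t within {0..T})"
      by (intro sine_sum_has_derivative dc)
    thus "((\<lambda>s. w s z) has_real_derivative sine_sum N (sine_transform N (time_deriv T w t)) z) (at t within {0..T})"
      unfolding w'_def[symmetric]
      by (rule has_field_derivative_transform_within[OF _ zero_less_one t])
        (simp add: w_eq)
  qed
  have "L2_inner w' (sine k) = galerkin_form \<gamma> \<gamma>1 \<gamma>2 (w t) (sine k)"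
  proof -
    have "sine k \<in> S_space N"
    proof -
      have "sine k = sine_sum N (\<lambda>l. if l = k then 1 else 0)"
        using k by (simp add: sine_sum_def fun_eq_iff if_distrib[of "\<lambda>x. x * _"] cong: if_cong)
      thus ?thesis by (simp add: S_space_eq)
    qed
    hence "L2_inner w' (sine k) + \<gamma> * L2_inner (laplacian (w t)) (laplacian (sine k))
        = L2_inner (\<lambda>z. phi \<gamma>1 \<gamma>2 (w t z)) (laplacian (sine k))
          + L2_inner (div_scalar (\<lambda>z. psi (w t z))) (sine k)"
      using w t unfolding semidiscrete_solution_def w'_def by blast
    thus ?thesis by (simp add: galerkin_form_def)
  qed
  moreover have "L2_inner w' (sine k) = pi\<^sup>2 * sine_transform N w' k"
    by (subst w'_eq) (rule L2_inner_sine_sum_sine[OF k])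
  ultimately have "sine_transform N w' k = galerkin_field \<gamma> \<gamma>1 \<gamma>2 N k (sine_transform N (w t))"
    by (simp add: galerkin_field_def w_eq[OF t] field_simps)
  thus "((\<lambda>s. sine_transform N (w s) k) has_real_derivative
      galerkin_field \<gamma> \<gamma>1 \<gamma>2 N k (sine_transform N (w t))) (at t within {0..T})"
    using dc[of k] by simp
qed

theorem theorem8:
  fixes \<gamma> \<gamma>1 \<gamma>2 T :: real and N :: nat and u0 :: "real \<times> real \<Rightarrow> real"
  assumes "\<gamma> > 0" and "\<gamma>2 > 0" and "N \<ge> 1"
    and "u0 \<in> H_space 2 \<inter> H10"
    and "T > 0"
  shows "\<exists>u. semidiscrete_solution \<gamma> \<gamma>1 \<gamma>2 N T u0 u
           \<and> (\<forall>w. semidiscrete_solution \<gamma> \<gamma>1 \<gamma>2 N T u0 w \<longrightarrow> (\<forall>t\<in>{0..T}. w t = u t))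
           \<and> u \<in> Bochner_Linf (H_per 2) (H_norm 2) T \<inter> Bochner_L2 (H_per 4) (H_norm 4) T"
proof -
  have "\<exists>g. weak_deriv 0 0 u0 g" using assms(4) by (auto simp: H_space_def)
  hence u0: "u0 \<in> L2" by (auto simp: weak_deriv_def)
  let ?F = "galerkin_field \<gamma> \<gamma>1 \<gamma>2 N"
  have cong: "?F k a = ?F k b" if "\<And>j. j \<in> modes N \<Longrightarrow> a j = b j" for k a b
  proof -
    have "sine_sum N a = sine_sum N b" using that by (auto simp: sine_sum_def fun_eq_iff)
    thus ?thesis by (simp add: galerkin_field_def)
  qed
  have "\<exists>x. \<forall>k\<in>modes N. x 0 k = L2_inner u0 (sine k) / pi\<^sup>2 \<and>
      (\<forall>t\<in>{0..T}. ((\<lambda>s. x s k) has_real_derivative ?F k (x t)) (at t within {0..T}))"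
    using assms
    by (intro ode_system_global_existence[where K = "(1 + \<gamma>1\<^sup>2 / (3 * \<gamma>2)) * (8 * (real N)\<^sup>2)"]
        lipschitz_galerkin_field galerkin_field_energy cong) auto
  then obtain x where x0: "\<And>k. k \<in> modes N \<Longrightarrow> x 0 k = L2_inner u0 (sine k) / pi\<^sup>2"
    and x: "\<And>k t. k \<in> modes N \<Longrightarrow> t \<in> {0..T} \<Longrightarrow>
      ((\<lambda>s. x s k) has_real_derivative ?F k (x t)) (at t within {0..T})" by blast
  define u where "u = (\<lambda>t. sine_sum N (x t))"
  have "semidiscrete_solution \<gamma> \<gamma>1 \<gamma>2 N T u0 u"
    unfolding u_def by (rule galerkin_solution[OF assms(5) u0 x0 x])
  moreover have "w t = u t" if w: "semidiscrete_solution \<gamma> \<gamma>1 \<gamma>2 N T u0 w" and t: "t \<in> {0..T}" for w t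
  proof -
    note c = galerkin_coefficients_ode[OF assms(5) u0 w]
    have "sine_transform N (w t) k = x t k" if "k \<in> modes N" for k
      by (rule ode_system_unique[where x = "\<lambda>s. sine_transform N (w s)",
            OF finite_modes lipschitz_galerkin_field c(2) x _ t that])
        (auto simp: c(1) x0)
    hence "sine_sum N (sine_transform N (w t)) = u t"
      by (simp add: u_def sine_sum_def fun_eq_iff)
    thus ?thesis
      using w t by (simp add: sine_sum_sine_transform semidiscrete_solution_def)
  qed
  moreover have "continuous_on {0..T} (\<lambda>t. x t k)" if "k \<in> modes N" for k
    by (rule DERIV_continuous_on[OF x[OF that]])
  hence "u \<in> Bochner_Linf (H_per 2) (H_norm 2) T \<inter> Bochner_L2 (H_per 4) (H_norm 4) T"
    unfolding u_def using sine_sum_Bochner[OF assms(5)] by blast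
  ultimately show ?thesis by blast
qed

end
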